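(* Let $\Omega\subset\mathbb{R}^d$ be a bounded Lipschitz domain, let $f=f^+-f^-$ with $f^+,f^-$ probability measures on $\overline{\Omega}$, and let $H_1,H_2:\mathbb{R}^d\to[0,+\infty)$ be continuous convex functions with $0\le H_1\le H_2$ and $\lim_{|s|\to+\infty}H_i(s)/|s|=+\infty$ for $i=1,2$. Let $k>0$ and, for measurable sets $C$, let $F(C)$ be the congested transport cost defined in the context and let $\operatorname{Per}(C)$ be the perimeter of $C$. Assume that $F(C)<+\infty$ for at least one subset $C$ of $\overline{\Omega}$ with finite perimeter. Then the minimization problem $$\min\big\{F(C)+k\operatorname{Per}(C)\ :\ C\subset\Omega\big\}$$ admits at least one optimal set $C_{opt}$.
   Context: Sets $C$ are Lebesgue measurable, and $\operatorname{Per}(C)$ denotes the De Giorgi perimeter in $\mathbb{R}^d$, i.e. the total variation in $\mathbb{R}^d$ of the distributional gradient of the characteristic function $1_C$ (equal to $+\infty$ if $1_C\notin BV(\mathbb{R}^d)$). Admissible fluxes: $\Gamma_f$ is the set of $\sigma\in L^1(\Omega;\mathbb{R}^d)$ such that $-\operatorname{div}\sigma=f$ in $\Omega$ and $\sigma\cdot n=0$ on $\partial\Omega$ in the weak sense, that is $$\int_\Omega\sigma\cdot\nabla\phi\,dx=\int_{\overline\Omega}\phi\,df^+-\int_{\overline\Omega}\phi\,df^-\qquad\text{for every }\phi\in C^\infty(\overline{\Omega}).$$ Cost function: for a measurable $C\subset\overline\Omega$, $$F(C)=\inf\left\{\int_{\Omega\setminus C}H_2(\sigma)\,dx+\int_{\Omega\cap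 C}H_1(\sigma)\,dx\ :\ \sigma\in\Gamma_f\right\},$$ with value $+\infty$ if no admissible $\sigma$ has finite cost. *)

theory Defs
  imports "HOL-Analysis.Analysis" "HOL-Probability.Probability"
begin

section \<open>Smooth functions and differential operators\<close>

text \<open>
  Functions of class $C^m$ on the whole space: all iterated partial derivatives up to order
  $m$ exist and are continuous.
\<close>

primrec C_class :: "nat \<Rightarrow> ('a::euclidean_space \<Rightarrow> 'b::real_normed_vector) \<Rightarrow> bool" where
  "C_class 0 \<phi> \<longleftrightarrow> continuous_on UNIV \<phi>"
| "C_class (Suc m) \<phi> \<longleftrightarrow> (\<forall>x. \<phi> differentiable (at x)) \<and>
     (\<forall>b\<in>Basis. C_class m (\<lambda>x. frechet_derivative \<phi> (at x) b))"

definition smooth :: "('a::euclidean_space \<Rightarrow> 'b::real_normed_vector) \<Rightarrow> bool" where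
  "smooth \<phi> \<longleftrightarrow> (\<forall>m. C_class m \<phi>)"

definition grad :: "('a::euclidean_space \<Rightarrow> real) \<Rightarrow> 'a \<Rightarrow> 'a" where
  "grad \<phi> x = (\<Sum>b\<in>Basis. frechet_derivative \<phi> (at x) b *\<^sub>R b)"

definition divergence :: "('a::euclidean_space \<Rightarrow> 'a) \<Rightarrow> 'a \<Rightarrow> real" where
  "divergence \<phi> x = (\<Sum>b\<in>Basis. frechet_derivative \<phi> (at x) b \<bullet> b)"


section \<open>Bounded Lipschitz domains\<close>

text \<open>
  Near each boundary point, \<open>\<Omega>\<close> is the strict epigraph of a Lipschitz function in suitable
  orthonormal coordinates: the unit vector \<open>e\<close> is the vertical direction, \<open>x \<bullet> e\<close> the height
  of \<open>x\<close>, and \<open>x - (x \<bullet> e) *\<^sub>R e\<close> its projection to the hyperplane orthogonal to \<open>e\<close>, on which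
  the graph function \<open>\<gamma>\<close> lives.
\<close>

definition bounded_Lipschitz_domain :: "'a::euclidean_space set \<Rightarrow> bool" where
  "bounded_Lipschitz_domain \<Omega> \<longleftrightarrow>
     open \<Omega> \<and> connected \<Omega> \<and> \<Omega> \<noteq> {} \<and> bounded \<Omega> \<and>
     (\<forall>p\<in>frontier \<Omega>. \<exists>r>0. \<exists>e \<gamma> L. norm e = 1 \<and> L-lipschitz_on {y. y \<bullet> e = 0} \<gamma> \<and>
        \<Omega> \<inter> ball p r = {x \<in> ball p r. \<gamma> (x - (x \<bullet> e) *\<^sub>R e) < x \<bullet> e})"


section \<open>Perimeter\<close>

definition test_fields :: "('a::euclidean_space \<Rightarrow> 'a) set" where
  "test_fields = {\<phi>. smooth \<phi> \<and> compact (closure {x. \<phi> x \<noteq> 0})}"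

text \<open>
  The distributional gradient of \<open>u\<close>, as a functional on compactly supported smooth vector
  fields.
\<close>

definition distr_grad :: "('a::euclidean_space \<Rightarrow> real) \<Rightarrow> ('a \<Rightarrow> 'a) \<Rightarrow> real" where
  "distr_grad u \<phi> = - (LINT x|lebesgue. u x * divergence \<phi> x)"

text \<open>
  The total variation in the whole space of a vector-valued distribution of order zero, by
  duality with test fields of sup norm at most one; it is finite exactly when the distribution
  is a finite vector measure.
\<close>

definition total_variation :: "(('a::euclidean_space \<Rightarrow> 'a) \<Rightarrow> real) \<Rightarrow> ennreal" where
  "total_variation T = (SUP \<phi>\<in>{\<phi> \<in> test_fields. \<forall>x. norm (\<phi> x) \<le> 1}. ennreal \<bar>T \<phi>\<bar>)"

definition BV :: "('a::euclidean_space \<Rightarrow> real) set" where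
  "BV = {u. integrable lebesgue u \<and> total_variation (distr_grad u) < \<infinity>}"

definition Per :: "'a::euclidean_space set \<Rightarrow> ennreal" where
  "Per C = (if indicator C \<in> (BV :: ('a \<Rightarrow> real) set)
            then total_variation (distr_grad (indicator C)) else \<infinity>)"


section \<open>Congested transport cost\<close>

text \<open>Probability measures on \<open>K\<close> are represented as Borel measures on the whole space
  concentrated on \<open>K\<close>.\<close>

definition prob_measure_on :: "'a::euclidean_space set \<Rightarrow> 'a measure \<Rightarrow> bool" where
  "prob_measure_on K \<mu> \<longleftrightarrow> sets \<mu> = sets borel \<and> prob_space \<mu> \<and> emeasure \<mu> K = 1"

text \<open>
  The source \<open>f\<close> is given by the pair \<open>f\<^sup>+\<close>, \<open>f\<^sup>-\<close> (not necessarily mutually singular).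
  The space $C^\infty(\overline\Omega)$ consists of the restrictions to $\overline\Omega$ of smooth
  functions on the whole space.
\<close>

definition admissible_fluxes ::
  "'a::euclidean_space set \<Rightarrow> 'a measure \<Rightarrow> 'a measure \<Rightarrow> ('a \<Rightarrow> 'a) set" where
  "admissible_fluxes \<Omega> fp fm = {\<sigma>. set_integrable lebesgue \<Omega> \<sigma> \<and>
     (\<forall>\<phi>. smooth \<phi> \<longrightarrow>
        (LINT x:\<Omega>|lebesgue. \<sigma> x \<bullet> grad \<phi> x) =
        (LINT x:closure \<Omega>|fp. \<phi> x) - (LINT x:closure \<Omega>|fm. \<phi> x))}"

definition congested_cost ::
  "'a::euclidean_space set \<Rightarrow> 'a measure \<Rightarrow> 'a measure \<Rightarrow> ('a \<Rightarrow> real) \<Rightarrow> ('a \<Rightarrow> real) \<Rightarrow>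
   'a set \<Rightarrow> ennreal" where
  "congested_cost \<Omega> fp fm H1 H2 C = (INF \<sigma>\<in>admissible_fluxes \<Omega> fp fm.
     (\<integral>\<^sup>+x\<in>\<Omega> - C. ennreal (H2 (\<sigma> x)) \<partial>lebesgue) + (\<integral>\<^sup>+x\<in>\<Omega> \<inter> C. ennreal (H1 (\<sigma> x)) \<partial>lebesgue))"

end

theory Submission
  imports Defs "HOL-Complex_Analysis.Great_Picard"
begin

text \<open>
  The direct method. A bound on the perimeters bounds the $L^1$ distance of each set of a minimizing
  sequence to its translates, hence to its averages over small balls. For a subsequence all these
  averages converge, so the sets converge almost everywhere to a limit set, and the perimeter is lower
  semicontinuous as a supremum of continuous functionals. The transport cost is lower semicontinuous
  too. Weak compactness in $L^1$ is avoided here: the admissible fluxes whose cost, restricted to the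
  points at which the sets have already stabilized, is below a given level form a decreasing sequence
  of convex closed sets in $L^1$. Minimizing the strictly convex functional
  $\int \sqrt{1 + |\sigma|^2}$ over them gives a Cauchy sequence, because the costs are
  superlinear, and its limit is an admissible flux for the limit set.
\<close>

section \<open>Smooth cutoff functions\<close>

text \<open>The perimeter is given only by duality with smooth fields. It reaches translates because
  the derivative of the integral of \<phi>(x - t h) over C in t is, up to sign, a pairing of the
  distributional gradient with a field of constant direction; smooth functions that imitate the sign
  of a difference of two indicators then recover its L1 norm. For the cost, the obstacle is that the
  integrand changes with the set, so near-optimal fluxes for different sets of the sequence lie in
  unrelated convex sets. Where the sets have stabilized, the integrand is already that of the limit
  set, and this makes the sets of fluxes comparable. Elsewhere only the lower bound by
  \<open>H1\<close> survives; it supplies the superlinear growth on all of \<Omega>.\<close>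

lemma C_class_SucI:
  assumes "\<And>x. (\<phi> has_derivative D x) (at x)" and "\<And>b. b \<in> Basis \<Longrightarrow> C_class m (\<lambda>x. D x b)"
  shows "C_class (Suc m) \<phi>"
proof -
  have "frechet_derivative \<phi> (at x) = D x" for x
    using frechet_derivative_at[OF assms(1)] by simp
  then show ?thesis
    using assms by (auto simp: differentiable_def)
qed

lemma C_class_Suc_has_derivative:
  "C_class (Suc m) \<phi> \<Longrightarrow> (\<phi> has_derivative frechet_derivative \<phi> (at x)) (at x)"
  by (simp add: frechet_derivative_works[symmetric])

lemma C_class_SucD: "C_class (Suc m) \<phi> \<Longrightarrow> C_class m \<phi>"
proof (induction m arbitrary: \<phi>)
  case 0
  then show ?case
    by (auto intro!: continuous_at_imp_continuous_on differentiable_imp_continuous_within)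
next
  case (Suc m)
  note C = Suc.prems[unfolded C_class.simps(2)[of "Suc m"]]
  show ?case
    unfolding C_class.simps(2)[of m] using C Suc.IH by blast
qed

lemma C_class_const: "C_class m (\<lambda>x. c)"
proof (induction m arbitrary: c)
  case (Suc m)
  show ?case
    by (rule C_class_SucI[OF has_derivative_const]) (rule Suc.IH)
qed simp

lemma C_class_add:
  fixes \<phi> \<psi> :: "'a::euclidean_space \<Rightarrow> 'b::real_normed_vector"
  shows "C_class m \<phi> \<Longrightarrow> C_class m \<psi> \<Longrightarrow> C_class m (\<lambda>x. \<phi> x + \<psi> x)"
proof (induction m arbitrary: \<phi> \<psi>)
  case 0
  then show ?case by (simp add: continuous_on_add)
next
  case (Suc m)
  show ?case
  proof (rule C_class_SucI[OF has_derivative_add[OF Suc.prems[THEN C_class_Suc_has_derivative]]])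
    fix b :: 'a assume "b \<in> Basis"
    then show "C_class m (\<lambda>x. frechet_derivative \<phi> (at x) b + frechet_derivative \<psi> (at x) b)"
      using Suc.prems by (intro Suc.IH) (simp_all only: C_class.simps(2))
  qed
qed

lemma C_class_bounded_linear_compose:
  fixes \<phi> :: "'a::euclidean_space \<Rightarrow> 'b::real_normed_vector"
  shows "bounded_linear L \<Longrightarrow> C_class m \<phi> \<Longrightarrow> C_class m (\<lambda>x. L (\<phi> x))"
proof (induction m arbitrary: \<phi>)
  case 0
  then show ?case by (simp add: bounded_linear.continuous_on)
next
  case (Suc m)
  show ?case
  proof (rule C_class_SucI[OF bounded_linear.has_derivative[OF Suc.prems(1) C_class_Suc_has_derivative[OF Suc.prems(2)]]])
    fix b :: 'a assume "b \<in> Basis"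
    then have "C_class m (\<lambda>x. frechet_derivative \<phi> (at x) b)"
      using Suc.prems(2) by (simp only: C_class.simps(2))
    then show "C_class m (\<lambda>x. L (frechet_derivative \<phi> (at x) b))"
      by (rule Suc.IH[OF Suc.prems(1)])
  qed
qed

lemma C_class_bounded_linear: "bounded_linear L \<Longrightarrow> C_class m L"
proof (induction m)
  case 0
  then show ?case by (simp add: linear_continuous_on)
next
  case (Suc m)
  then show ?case
    by (intro C_class_SucI[OF bounded_linear_imp_has_derivative] C_class_const)
qed

lemma C_class_shift:
  fixes \<phi> :: "'a::euclidean_space \<Rightarrow> 'b::real_normed_vector"
  shows "C_class m \<phi> \<Longrightarrow> C_class m (\<lambda>x. \<phi> (x + a))"
proof (induction m arbitrary: \<phi>)
  case 0
  then show ?case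
    by (simp add: continuous_on_compose2[of UNIV \<phi> UNIV "\<lambda>x. x + a"] continuous_on_add)
next
  case (Suc m)
  have "((\<lambda>x. \<phi> (x + a)) has_derivative frechet_derivative \<phi> (at (x + a))) (at x)" for x
  proof -
    have "((\<lambda>x. x + a) has_derivative (\<lambda>h. h)) (at x)"
      by (auto intro!: derivative_eq_intros)
    then show ?thesis
      using C_class_Suc_has_derivative[OF Suc.prems] by (rule has_derivative_compose)
  qed
  then show ?case
  proof (rule C_class_SucI)
    fix b :: 'a assume "b \<in> Basis"
    then have "C_class m (\<lambda>x. frechet_derivative \<phi> (at x) b)"
      using Suc.prems by (simp only: C_class.simps(2))
    then show "C_class m (\<lambda>x. frechet_derivative \<phi> (at (x + a)) b)"
      by (rule Suc.IH)
  qed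
qed

lemma C_class_mult:
  fixes \<phi> \<psi> :: "'a::euclidean_space \<Rightarrow> real"
  shows "C_class m \<phi> \<Longrightarrow> C_class m \<psi> \<Longrightarrow> C_class m (\<lambda>x. \<phi> x * \<psi> x)"
proof (induction m arbitrary: \<phi> \<psi>)
  case 0
  then show ?case by (simp add: continuous_on_mult)
next
  case (Suc m)
  show ?case
  proof (rule C_class_SucI[OF has_derivative_mult[OF Suc.prems[THEN C_class_Suc_has_derivative]]])
    fix b :: 'a assume "b \<in> Basis"
    then show "C_class m (\<lambda>x. \<phi> x * frechet_derivative \<psi> (at x) b + frechet_derivative \<phi> (at x) b * \<psi> x)"
      using Suc.prems by (intro C_class_add Suc.IH C_class_SucD[OF Suc.prems(1)] C_class_SucD[OF Suc.prems(2)])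
        (simp_all only: C_class.simps(2))
  qed
qed

lemma C_class_sum: "finite I \<Longrightarrow> (\<And>i. i \<in> I \<Longrightarrow> C_class m (\<phi> i)) \<Longrightarrow> C_class m (\<lambda>x. \<Sum>i\<in>I. \<phi> i x)"
  by (induction I rule: finite_induct) (simp_all add: C_class_const C_class_add)

text \<open>The chain rule brings in the outer derivative f' (q x), so an induction for one fixed f
  would not close. A family \<open>F\<close> stable under derivatives does; it is used with
  \<open>range flat_fun\<close> and with \<open>{exp}\<close>.\<close>

lemma C_class_compose_real:
  fixes q :: "'a::euclidean_space \<Rightarrow> real" and F :: "(real \<Rightarrow> real) set"
  assumes F: "\<And>f. f \<in> F \<Longrightarrow> \<exists>f'\<in>F. \<forall>t. (f has_real_derivative f' t) (at t)"
  shows "f \<in> F \<Longrightarrow> C_class m q \<Longrightarrow> C_class m (\<lambda>x. f (q x))"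
proof (induction m arbitrary: f)
  case 0
  then obtain f' where "\<And>t. (f has_real_derivative f' t) (at t)"
    using F by blast
  then have "continuous_on UNIV f"
    by (auto intro!: continuous_at_imp_continuous_on DERIV_isCont)
  then show ?case
    using 0(2) by (simp add: continuous_on_compose2[of UNIV f UNIV q])
next
  case (Suc m)
  obtain f' where f': "f' \<in> F" "\<And>t. (f has_real_derivative f' t) (at t)"
    using F Suc.prems(1) by blast
  have "((\<lambda>x. f (q x)) has_derivative (\<lambda>h. f' (q x) * frechet_derivative q (at x) h)) (at x)" for x
    using has_derivative_compose[OF C_class_Suc_has_derivative[OF Suc.prems(2)]
        f'(2)[unfolded has_field_derivative_def]] by simp
  then show ?case
  proof (rule C_class_SucI)
    fix b :: 'a assume "b \<in> Basis"
    then show "C_class m (\<lambda>x. f' (q x) * frechet_derivative q (at x) b)"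
      using Suc.prems(2)
      by (intro C_class_mult[OF Suc.IH[OF f'(1) C_class_SucD[OF Suc.prems(2)]]]) (simp only: C_class.simps(2))
  qed
qed

text \<open>The factor \<open>p\<close> makes this family of flat functions closed under differentiation.\<close>

definition flat_fun :: "real poly \<Rightarrow> real \<Rightarrow> real" where
  "flat_fun p t = (if t > 0 then poly p (inverse t) * exp (- inverse t) else 0)"

text \<open>With u = 1/t this is the decay of flat functions as t decreases to 0.\<close>

lemma tendsto_poly_times_exp_minus: "((\<lambda>u. poly p u * exp (- u :: real)) \<longlongrightarrow> 0) at_top"
proof -
  have "((\<lambda>u. \<Sum>i\<le>degree p. coeff p i * (u ^ i / exp u)) \<longlongrightarrow> (\<Sum>i\<le>degree p. coeff p i * 0)) at_top"
    by (intro tendsto_intros tendsto_power_div_exp_0)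
  then show ?thesis
    by (simp add: poly_altdef exp_minus sum_divide_distrib divide_inverse sum_distrib_right mult.assoc)
qed

text \<open>With u = 1/t one has d/dt = - u^2 d/du, so p(u) exp(-u) has derivative u^2 (p - p')(u)
  exp(-u), and \<open>[:0, 0, 1:]\<close> is u^2. At t = 0 the right difference quotient is the flat
  function of the polynomial u p(u), which tends to 0.\<close>

lemma flat_fun_has_derivative:
  "(flat_fun p has_real_derivative flat_fun ([:0, 0, 1:] * (p - pderiv p)) t) (at t)"
proof (cases t "0 :: real" rule: linorder_cases)
  case greater
  have "((\<lambda>t. poly p (inverse t) * exp (- inverse t)) has_real_derivative
      flat_fun ([:0, 0, 1:] * (p - pderiv p)) t) (at t)"
    using greater unfolding flat_fun_def
    by (auto intro!: derivative_eq_intros poly_DERIV[THEN DERIV_chain2] simp: field_simps power2_eq_square)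
  then show ?thesis
    by (rule has_field_derivative_transform_within_open[of _ _ _ "{0<..}"])
      (use greater in \<open>auto simp: flat_fun_def\<close>)
next
  case less
  have "((\<lambda>t. 0) has_real_derivative 0) (at t)" by simp
  then have "(flat_fun p has_real_derivative 0) (at t)"
    by (rule has_field_derivative_transform_within_open[of _ _ _ "{..<0}"])
      (use less in \<open>auto simp: flat_fun_def\<close>)
  then show ?thesis
    using less by (simp add: flat_fun_def)
next
  case equal
  have "((\<lambda>h. flat_fun p h / h) \<longlongrightarrow> 0) (at 0)"
  proof (rule filterlim_split_at)
    have "((\<lambda>h. poly (pCons 0 p) (inverse h) * exp (- inverse h)) \<longlongrightarrow> 0) (at_right (0::real))"
      using tendsto_poly_times_exp_minus filterlim_inverse_at_top_right by (rule filterlim_compose)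
    then show "((\<lambda>h. flat_fun p h / h) \<longlongrightarrow> 0) (at_right 0)"
      by (rule Lim_transform_eventually)
        (auto simp: eventually_at_filter flat_fun_def divide_inverse mult_ac)
    show "((\<lambda>h. flat_fun p h / h) \<longlongrightarrow> 0) (at_left 0)"
      by (rule tendsto_eventually) (auto simp: eventually_at_filter flat_fun_def)
  qed
  then show ?thesis
    using equal by (simp add: DERIV_def flat_fun_def)
qed

text \<open>The squared norm is a polynomial in the coordinates, hence smooth also at c. For r > 0
  the bump is positive exactly on \<open>ball c r\<close>.\<close>

lemma smooth_bump:
  fixes c :: "'a::euclidean_space"
  shows "smooth (\<lambda>x. flat_fun 1 (r\<^sup>2 - (norm (x - c))\<^sup>2))"
proof -
  have q: "C_class m (\<lambda>x. r\<^sup>2 - (norm (x - c))\<^sup>2)" for m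
  proof -
    have "C_class m (\<lambda>x. (x + - c) \<bullet> b)" for b :: 'a
      using C_class_shift[OF C_class_bounded_linear[OF bounded_linear_inner_left]] .
    then have "C_class m (\<lambda>x. r\<^sup>2 + (\<Sum>b\<in>Basis. - 1 * (((x + - c) \<bullet> b) * ((x + - c) \<bullet> b))))"
      by (intro C_class_add C_class_sum C_class_mult C_class_const) auto
    moreover have "r\<^sup>2 + (\<Sum>b\<in>Basis. - 1 * (((x + - c) \<bullet> b) * ((x + - c) \<bullet> b))) = r\<^sup>2 - (norm (x - c))\<^sup>2" for x
      unfolding power2_norm_eq_inner by (subst euclidean_inner) (simp add: sum_negf)
    ultimately show ?thesis by simp
  qed
  have "\<exists>f'\<in>range flat_fun. \<forall>t. (f has_real_derivative f' t) (at t)" if "f \<in> range flat_fun" for f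
    using that flat_fun_has_derivative by blast
  then show ?thesis
    unfolding smooth_def by (intro allI C_class_compose_real[OF _ rangeI q])
qed

lemma flat_fun_1:
  "0 \<le> flat_fun 1 t" "flat_fun 1 t = 0 \<longleftrightarrow> \<not> t > 0"
  by (auto simp: flat_fun_def)

text \<open>Cover K by finitely many balls that avoid L and add their bumps. Only the sign is
  controlled here; \<open>smooth_separation\<close> takes care of the size.\<close>

lemma smooth_Urysohn_pos:
  fixes K L :: "'a::euclidean_space set"
  assumes "compact K" "closed L" "K \<inter> L = {}"
  obtains \<theta> :: "'a \<Rightarrow> real" where "smooth \<theta>" "\<And>x. 0 \<le> \<theta> x" "\<And>x. x \<in> K \<Longrightarrow> 0 < \<theta> x"
    "\<And>x. x \<in> L \<Longrightarrow> \<theta> x = 0" "bounded {x. \<theta> x \<noteq> 0}"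
proof -
  have "\<exists>r>0. ball c r \<subseteq> - L" if "c \<in> K" for c
    using open_contains_ball[of "- L"] assms that by auto
  then obtain r where r: "\<And>c. c \<in> K \<Longrightarrow> r c > 0" "\<And>c. c \<in> K \<Longrightarrow> ball c (r c) \<subseteq> - L"
    by metis
  obtain C where C: "C \<subseteq> K" "finite C" "K \<subseteq> (\<Union>c\<in>C. ball c (r c))"
    by (rule compactE_image[OF assms(1), of K "\<lambda>c. ball c (r c)"]) (use r in auto)
  define \<theta> where "\<theta> x = (\<Sum>c\<in>C. flat_fun 1 ((r c)\<^sup>2 - (norm (x - c))\<^sup>2))" for x
  have pos: "(r c)\<^sup>2 - (norm (x - c))\<^sup>2 > 0 \<longleftrightarrow> x \<in> ball c (r c)" if "c \<in> C" for c x
  proof -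
    have "0 < r c" using that C r by auto
    then show ?thesis
      by (auto simp: dist_norm norm_minus_commute intro: power_strict_mono dest: power2_less_imp_less)
  qed
  have 0: "\<theta> x = 0 \<longleftrightarrow> (\<forall>c\<in>C. x \<notin> ball c (r c))" for x
  proof -
    have "flat_fun 1 ((r c)\<^sup>2 - (norm (x - c))\<^sup>2) = 0 \<longleftrightarrow> x \<notin> ball c (r c)" if "c \<in> C" for c
      using flat_fun_1(2) pos[OF that] by blast
    then show ?thesis
      unfolding \<theta>_def sum_nonneg_eq_0_iff[OF C(2) flat_fun_1(1)] by blast
  qed
  show thesis
  proof (rule that[of \<theta>])
    show "smooth \<theta>"
      unfolding smooth_def \<theta>_def
      by (intro allI C_class_sum C(2)) (use smooth_bump[unfolded smooth_def] in blast)
    show nonneg: "0 \<le> \<theta> x" for x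
      unfolding \<theta>_def by (intro sum_nonneg flat_fun_1(1))
    show "0 < \<theta> x" if "x \<in> K" for x
    proof -
      have "\<theta> x \<noteq> 0"
        using that C(3) unfolding 0 by blast
      then show ?thesis
        using nonneg[of x] by simp
    qed
    show "\<theta> x = 0" if "x \<in> L" for x
      using that C(1) r(2) by (subst 0) blast
    have "{x. \<theta> x \<noteq> 0} \<subseteq> (\<Union>c\<in>C. ball c (r c))"
      using 0 by auto
    then show "bounded {x. \<theta> x \<noteq> 0}"
      by (rule bounded_subset[rotated]) (use C(2) in auto)
  qed
qed

text \<open>The function is exp(-n \<theta>2) - exp(-n \<theta>1) for large n, where \<theta>1 is
  positive on K and zero on L, and \<theta>2 the other way round. Both terms lie in (0, 1], which
  bounds the difference by 1; where \<theta>1 and \<theta>2 both vanish the terms cancel, so the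
  support is bounded. On K the first term is 1 and the second small, on L conversely.\<close>

lemma smooth_separation:
  fixes K L :: "'a::euclidean_space set"
  assumes "compact K" "compact L" "K \<inter> L = {}" "\<epsilon> > 0"
  obtains \<phi> :: "'a \<Rightarrow> real" where "smooth \<phi>" "bounded {x. \<phi> x \<noteq> 0}" "\<And>x. \<bar>\<phi> x\<bar> \<le> 1"
    "\<And>x. x \<in> K \<Longrightarrow> \<phi> x \<ge> 1 - \<epsilon>" "\<And>x. x \<in> L \<Longrightarrow> \<phi> x \<le> \<epsilon> - 1"
proof -
  obtain \<theta>1 :: "'a \<Rightarrow> real" where \<theta>1: "smooth \<theta>1" "\<And>x. 0 \<le> \<theta>1 x" "\<And>x. x \<in> K \<Longrightarrow> 0 < \<theta>1 x"
    "\<And>x. x \<in> L \<Longrightarrow> \<theta>1 x = 0" "bounded {x. \<theta>1 x \<noteq> 0}"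
    using smooth_Urysohn_pos[of K L] assms compact_imp_closed by metis
  obtain \<theta>2 :: "'a \<Rightarrow> real" where \<theta>2: "smooth \<theta>2" "\<And>x. 0 \<le> \<theta>2 x" "\<And>x. x \<in> L \<Longrightarrow> 0 < \<theta>2 x"
    "\<And>x. x \<in> K \<Longrightarrow> \<theta>2 x = 0" "bounded {x. \<theta>2 x \<noteq> 0}"
    using smooth_Urysohn_pos[of L K] assms compact_imp_closed by (metis inf_commute)
  have lower: "\<exists>N. \<forall>n\<ge>N. \<forall>x\<in>S. exp (- n * \<theta> x) \<le> \<epsilon>"
    if S: "compact S" "smooth \<theta>" "\<And>x. x \<in> S \<Longrightarrow> 0 < \<theta> x" for S and \<theta> :: "'a \<Rightarrow> real"
  proof (cases "S = {}")
    case False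
    have "continuous_on S \<theta>"
      using S(2) C_class.simps(1)[of \<theta>] unfolding smooth_def by (metis continuous_on_subset subset_UNIV)
    then obtain y where y: "y \<in> S" "\<And>x. x \<in> S \<Longrightarrow> \<theta> y \<le> \<theta> x"
      using continuous_attains_inf[OF S(1) False] by blast
    \<comment> \<open>The threshold solves exp(-n \<theta>(y)) = \<epsilon> at a minimum point y of
      \<theta> on S; taking n nonnegative lets \<theta>(y) \<le> \<theta>(x) be multiplied by
      it.\<close>
    have "exp (- n * \<theta> x) \<le> \<epsilon>" if n: "n \<ge> max 0 (- ln \<epsilon> / \<theta> y)" and x: "x \<in> S" for n x
    proof -
      have "- ln \<epsilon> \<le> n * \<theta> y"
        using n S(3)[OF y(1)] by (simp add: field_simps)
      also have "\<dots> \<le> n * \<theta> x"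
        using n y(2)[OF x] by (intro mult_left_mono) auto
      finally have "exp (- n * \<theta> x) \<le> exp (ln \<epsilon>)"
        by simp
      then show ?thesis
        using \<open>\<epsilon> > 0\<close> by simp
    qed
    then show ?thesis by blast
  qed auto
  obtain N1 N2 where N: "\<And>n x. n \<ge> N1 \<Longrightarrow> x \<in> K \<Longrightarrow> exp (- n * \<theta>1 x) \<le> \<epsilon>"
    "\<And>n x. n \<ge> N2 \<Longrightarrow> x \<in> L \<Longrightarrow> exp (- n * \<theta>2 x) \<le> \<epsilon>"
    using lower[OF assms(1) \<theta>1(1,3)] lower[OF assms(2) \<theta>2(1,3)] by metis
  define n where "n = Max {0, N1, N2}"
  have n: "n \<ge> 0" "n \<ge> N1" "n \<ge> N2" by (auto simp: n_def)
  define \<phi> where "\<phi> x = exp (- n * \<theta>2 x) + - 1 * exp (- n * \<theta>1 x)" for x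
  have exp_smooth: "C_class m (\<lambda>x. exp (- n * \<theta> x))" if "smooth \<theta>" for m and \<theta> :: "'a \<Rightarrow> real"
    using that
    by (intro C_class_compose_real[where F = "{exp}" and f = exp] C_class_mult C_class_const)
      (simp_all add: smooth_def DERIV_exp)
  have range: "0 < exp (- n * \<theta>1 x)" "exp (- n * \<theta>1 x) \<le> 1" "0 < exp (- n * \<theta>2 x)" "exp (- n * \<theta>2 x) \<le> 1" for x
    using n \<theta>1(2)[of x] \<theta>2(2)[of x] by auto
  show thesis
  proof (rule that[of \<phi>])
    show "smooth \<phi>"
      using \<theta>1(1) \<theta>2(1) unfolding smooth_def[of \<phi>] \<phi>_def
      by (intro allI C_class_add C_class_mult C_class_const exp_smooth)
    have "{x. \<phi> x \<noteq> 0} \<subseteq> {x. \<theta>1 x \<noteq> 0} \<union> {x. \<theta>2 x \<noteq> 0}"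
      by (auto simp: \<phi>_def)
    then show "bounded {x. \<phi> x \<noteq> 0}"
      using \<theta>1(5) \<theta>2(5) by (meson bounded_Un bounded_subset)
    show "\<bar>\<phi> x\<bar> \<le> 1" for x
      using range[of x] unfolding \<phi>_def by linarith
    show "\<phi> x \<ge> 1 - \<epsilon>" if "x \<in> K" for x
      using N(1)[OF n(2) that] \<theta>2(4)[OF that] by (simp add: \<phi>_def)
    show "\<phi> x \<le> \<epsilon> - 1" if "x \<in> L" for x
      using N(2)[OF n(3) that] \<theta>1(4)[OF that] by (simp add: \<phi>_def)
  qed
qed

section \<open>Translations of sets of finite perimeter\<close>

lemma lborel_integral_shift:
  fixes f :: "'a::euclidean_space \<Rightarrow> 'b::{banach, second_countable_topology}"
  assumes [measurable]: "f \<in> borel_measurable borel"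
  shows "(LINT x|lborel. f (h + x)) = (LINT x|lborel. f x)"
proof -
  have "(LINT x|lborel. f x) = (LINT x|distr lborel borel ((+) h). f x)"
    by (simp add: lborel_distr_plus)
  also have "\<dots> = (LINT x|lborel. f (h + x))"
    by (rule integral_distr) auto
  finally show ?thesis by simp
qed

section \<open>L1 distances of sets by smooth duality\<close>

lemma integrable_indicator_bounded:
  fixes X :: "'a::euclidean_space set"
  assumes "X \<in> sets borel" "bounded X"
  shows "integrable lborel (indicat_real X)"
  using assms emeasure_bounded_finite by (intro integrable_real_indicator) auto

text \<open>The left side is the integral of the difference of the indicators times its sign. By
  inner regularity a smooth \<phi> imitates this sign: it is near 1 on a compact part of A - B and
  near -1 on a compact part of B - A.\<close>

lemma L1_norm_duality_sets:
  fixes A B :: "'a::euclidean_space set"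
  assumes A: "A \<in> sets borel" "bounded A" and B: "B \<in> sets borel" "bounded B"
    and le: "\<And>\<phi>. smooth \<phi> \<Longrightarrow> bounded {x. \<phi> x \<noteq> 0} \<Longrightarrow> (\<And>x. \<bar>\<phi> x\<bar> \<le> 1) \<Longrightarrow>
      \<bar>LINT x|lborel. (indicat_real A x - indicat_real B x) * \<phi> x\<bar> \<le> c"
  shows "measure lborel (A - B) + measure lborel (B - A) \<le> c"
proof (rule field_le_epsilon)
  fix e :: real assume "e > 0"
  let ?m = "measure lborel"
  define P where "P = A - B" define Q where "Q = B - A"
  have P: "P \<in> sets borel" "bounded P" and Q: "Q \<in> sets borel" "bounded Q"
    using assms unfolding P_def Q_def by (auto intro: bounded_subset)
  define S where "S = ?m P + ?m Q"
  have S: "S \<ge> 0" by (simp add: S_def)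
  \<comment> \<open>The loss is at most \<delta> S, because \<phi> is only \<delta>-close to the
    sign on K and L, plus twice the measure of P - K and Q - L, where \<phi> may have the wrong
    sign; that is less than 4 \<delta>. The denominator S + 5 absorbs both and is positive.\<close>
  define \<delta> where "\<delta> = e / (S + 5)"
  have \<delta>: "\<delta> > 0" using \<open>e > 0\<close> S by (simp add: \<delta>_def)
  have inner: "\<exists>K. compact K \<and> K \<subseteq> X \<and> ?m (X - K) < \<delta>" if X: "X \<in> sets borel" "bounded X" for X :: "'a set"
  proof -
    have "X \<in> sets lebesgue" using X by simp
    then obtain T where T: "closed T" "T \<subseteq> X" "X - T \<in> lmeasurable" "emeasure lebesgue (X - T) < ennreal \<delta>"
      using sets_lebesgue_inner_closed \<delta> by blast
    have "compact T"
      using T X by (simp add: compact_eq_bounded_closed bounded_subset)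
    moreover have "?m (X - T) < \<delta>"
    proof -
      have "X - T \<in> sets borel" using X T by auto
      then have "?m (X - T) = measure lebesgue (X - T)" by simp
      also have "\<dots> < \<delta>"
        using T(3,4) \<delta> by (simp add: emeasure_eq_measure2 ennreal_less_iff)
      finally show ?thesis .
    qed
    ultimately show ?thesis using T(2) by blast
  qed
  obtain K where K: "compact K" "K \<subseteq> P" "?m (P - K) < \<delta>" using inner[OF P] by blast
  obtain L where L: "compact L" "L \<subseteq> Q" "?m (Q - L) < \<delta>" using inner[OF Q] by blast
  obtain \<phi> :: "'a \<Rightarrow> real" where \<phi>: "smooth \<phi>" "bounded {x. \<phi> x \<noteq> 0}" "\<And>x. \<bar>\<phi> x\<bar> \<le> 1"
    "\<And>x. x \<in> K \<Longrightarrow> \<phi> x \<ge> 1 - \<delta>" "\<And>x. x \<in> L \<Longrightarrow> \<phi> x \<le> \<delta> - 1"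
    by (rule smooth_separation[OF K(1) L(1) _ \<delta>]) (use K(2) L(2) P_def Q_def in auto)
  have [measurable]: "\<phi> \<in> borel_measurable borel"
    using \<phi>(1) C_class.simps(1)[of \<phi>] unfolding smooth_def by (metis borel_measurable_continuous_onI)
  note fin = integrable_indicator_bounded
  have Kb: "K \<in> sets borel" "bounded K" and Lb: "L \<in> sets borel" "bounded L"
    using K L by (auto intro: compact_imp_bounded borel_compact)
  have PK: "P - K \<in> sets borel" "bounded (P - K)" and QL: "Q - L \<in> sets borel" "bounded (Q - L)"
    using P Q Kb Lb by (auto intro: bounded_subset)
  note ints = fin[OF P] fin[OF Q] fin[OF Kb] fin[OF Lb] fin[OF PK] fin[OF QL] fin[OF A] fin[OF B]
  have main: "integrable lborel (\<lambda>x. (indicat_real A x - indicat_real B x) * \<phi> x)"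
  proof (rule Bochner_Integration.integrable_bound[OF Bochner_Integration.integrable_add[OF fin[OF A] fin[OF B]]])
    show "AE x in lborel. norm ((indicat_real A x - indicat_real B x) * \<phi> x) \<le> norm (indicat_real A x + indicat_real B x)"
      using \<phi>(3) by (intro AE_I2) (auto simp: indicator_def abs_mult)
  qed (use A B in measurable)
  have mP: "?m P = (LINT x|lborel. indicat_real P x)" and mQ: "?m Q = (LINT x|lborel. indicat_real Q x)"
    and mPK: "?m (P - K) = (LINT x|lborel. indicat_real (P - K) x)"
    and mQL: "?m (Q - L) = (LINT x|lborel. indicat_real (Q - L) x)"
    by simp_all
  have "(1 - \<delta>) * S - 2 * (?m (P - K) + ?m (Q - L))
      = (LINT x|lborel. (1 - \<delta>) * (indicat_real P x + indicat_real Q x)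
          - 2 * (indicat_real (P - K) x + indicat_real (Q - L) x))"
    unfolding S_def mP mQ mPK mQL using ints by simp
  also have "\<dots> \<le> (LINT x|lborel. (indicat_real A x - indicat_real B x) * \<phi> x)"
  proof (rule integral_mono)
    fix x
    have "(1 - \<delta>) * (indicat_real P x + indicat_real Q x) \<le> 1"
      using \<delta> by (auto simp: indicator_def P_def Q_def)
    then show "(1 - \<delta>) * (indicat_real P x + indicat_real Q x)
          - 2 * (indicat_real (P - K) x + indicat_real (Q - L) x)
        \<le> (indicat_real A x - indicat_real B x) * \<phi> x"
      using \<phi>(3)[of x] \<phi>(4)[of x] \<phi>(5)[of x] K(2) L(2) \<delta>
      by (auto simp: indicator_def P_def Q_def abs_le_iff)
  qed (use ints main in auto)
  also have "\<dots> \<le> c"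
    using le[OF \<phi>(1-3)] by simp
  finally have "(1 - \<delta>) * S - 2 * (?m (P - K) + ?m (Q - L)) \<le> c" .
  then have "S \<le> c + \<delta> * (S + 5)"
    using K(3) L(3) \<delta> by (simp add: algebra_simps)
  also have "\<dots> = c + e"
    using S by (simp add: \<delta>_def)
  finally show "?m (A - B) + ?m (B - A) \<le> c + e"
    by (simp add: S_def P_def Q_def)
qed

text \<open>\<open>C_class\<close> speaks of partial derivatives along the basis; linearity yields
  every direction h. The derivative vanishes off the compact closure of the support, so its
  continuity there bounds it everywhere.\<close>

lemma bounded_frechet_derivative:
  fixes \<phi> :: "'a::euclidean_space \<Rightarrow> 'b::euclidean_space"
  assumes "smooth \<phi>" "bounded {x. \<phi> x \<noteq> 0}"
  shows "continuous_on UNIV (\<lambda>x. frechet_derivative \<phi> (at x) h)"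
    and "\<exists>B. \<forall>x. norm (frechet_derivative \<phi> (at x) h) \<le> B"
proof -
  have C1: "C_class (Suc 0) \<phi>" using assms(1) by (simp only: smooth_def)
  note der = C_class_Suc_has_derivative[OF C1]
  have lin: "bounded_linear (frechet_derivative \<phi> (at x))" for x
    using der by (rule has_derivative_bounded_linear)
  have eq: "frechet_derivative \<phi> (at x) h = (\<Sum>b\<in>Basis. (h \<bullet> b) *\<^sub>R frechet_derivative \<phi> (at x) b)" for x
  proof -
    note l = bounded_linear.linear[OF lin[of x]]
    have "frechet_derivative \<phi> (at x) h = frechet_derivative \<phi> (at x) (\<Sum>b\<in>Basis. (h \<bullet> b) *\<^sub>R b)"
      by (simp add: euclidean_representation)
    then show ?thesis
      by (simp add: linear_sum[OF l] linear_scale[OF l])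
  qed
  show cont: "continuous_on UNIV (\<lambda>x. frechet_derivative \<phi> (at x) h)"
    unfolding eq using C1 by (intro continuous_on_sum continuous_on_scaleR continuous_on_const) simp
  let ?S = "closure {x. \<phi> x \<noteq> 0}"
  have "compact ?S" using assms(2) by (simp add: compact_closure)
  then have "compact ((\<lambda>x. frechet_derivative \<phi> (at x) h) ` ?S)"
    using cont by (intro compact_continuous_image) (auto intro: continuous_on_subset)
  then have "bounded ((\<lambda>x. frechet_derivative \<phi> (at x) h) ` ?S)"
    by (rule compact_imp_bounded)
  then obtain B where B: "\<And>x. x \<in> ?S \<Longrightarrow> norm (frechet_derivative \<phi> (at x) h) \<le> B"
    unfolding bounded_iff by auto
  have "norm (frechet_derivative \<phi> (at x) h) \<le> max B 0" for x
  proof (cases "x \<in> ?S")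
    case True
    then show ?thesis using B by (simp add: le_max_iff_disj)
  next
    case False
    have "((\<lambda>x. 0) has_derivative frechet_derivative \<phi> (at x)) (at x)"
      by (rule has_derivative_transform_within_open[OF der, of "- ?S"])
        (use False closure_subset[of "{x. \<phi> x \<noteq> 0}"] in auto)
    then have "frechet_derivative \<phi> (at x) = (\<lambda>h. 0)"
      using has_derivative_const has_derivative_unique by blast
    then show ?thesis by simp
  qed
  then show "\<exists>B. \<forall>x. norm (frechet_derivative \<phi> (at x) h) \<le> B" by blast
qed

section \<open>From the total variation to translates\<close>

lemma distr_grad_le:
  fixes \<phi> :: "'a::euclidean_space \<Rightarrow> 'a"
  assumes "total_variation (distr_grad u) \<le> ennreal M" "M \<ge> 0" "smooth \<phi>" "bounded {x. \<phi> x \<noteq> 0}" "\<And>x. norm (\<phi> x) \<le> 1"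
  shows "\<bar>LINT x|lebesgue. u x * divergence \<phi> x\<bar> \<le> M"
proof -
  have "ennreal \<bar>distr_grad u \<phi>\<bar> \<le> total_variation (distr_grad u)"
    unfolding total_variation_def
    using assms(3-5) by (intro SUP_upper) (auto simp: test_fields_def compact_closure)
  also note assms(1)
  finally show ?thesis
    using assms(2) by (simp add: distr_grad_def)
qed

text \<open>Let g(t) be the integral of \<phi>(x - t h) over C. Its derivative is the integral over
  C of the divergence of a test field of norm at most 1, times - |h|, so it is at most |h| M in
  absolute value. The mean value inequality between 0 and 1 concludes.\<close>

lemma translation_test:
  fixes C :: "'a::euclidean_space set" and \<phi> :: "'a \<Rightarrow> real"
  assumes C: "C \<in> sets borel" "bounded C"
    and tv: "total_variation (distr_grad (indicator C)) \<le> ennreal M" "M \<ge> 0"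
    and \<phi>: "smooth \<phi>" "bounded {x. \<phi> x \<noteq> 0}" "\<And>x. \<bar>\<phi> x\<bar> \<le> 1"
  shows "\<bar>(LINT x|lborel. indicat_real C x * \<phi> (x - h)) - (LINT x|lborel. indicat_real C x * \<phi> x)\<bar> \<le> norm h * M"
proof -
  define D where "D x = frechet_derivative \<phi> (at x) h" for x
  have C1: "C_class (Suc 0) \<phi>" using \<phi>(1) by (simp only: smooth_def)
  note der = C_class_Suc_has_derivative[OF C1]
  have lin: "bounded_linear (frechet_derivative \<phi> (at x))" for x
    using der by (rule has_derivative_bounded_linear)
  have Dcont: "continuous_on UNIV D"
    unfolding D_def by (rule bounded_frechet_derivative[OF \<phi>(1,2)])
  obtain B where B: "\<And>x. \<bar>D x\<bar> \<le> B"
    using bounded_frechet_derivative(2)[OF \<phi>(1,2), of h] unfolding D_def real_norm_def by blast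
  have \<phi>cont: "continuous_on UNIV \<phi>"
    using \<phi>(1) C_class.simps(1)[of \<phi>] unfolding smooth_def by metis
  have [measurable]: "\<phi> \<in> borel_measurable borel" "D \<in> borel_measurable borel" "C \<in> sets borel"
    using \<phi>cont Dcont C by (auto intro: borel_measurable_continuous_onI)
  have fin: "integrable lborel (indicat_real C)"
    using C by (rule integrable_indicator_bounded)
  define g where "g t = (LINT x|lborel. indicat_real C x * \<phi> (x - t *\<^sub>R h))" for t
  define g' where "g' t = - (LINT x|lborel. indicat_real C x * D (x - t *\<^sub>R h))" for t
  have line: "((\<lambda>t. \<phi> (x - t *\<^sub>R h)) has_real_derivative - D (x - t *\<^sub>R h)) (at t within T)" for x t T
  proof -
    have "((\<lambda>t. x - t *\<^sub>R h) has_derivative (\<lambda>s. - (s *\<^sub>R h))) (at t within T)"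
      by (auto intro!: derivative_eq_intros)
    from has_derivative_compose[OF this der]
    have "((\<lambda>t. \<phi> (x - t *\<^sub>R h)) has_derivative (\<lambda>s. frechet_derivative \<phi> (at (x - t *\<^sub>R h)) (- (s *\<^sub>R h)))) (at t within T)" .
    moreover have "frechet_derivative \<phi> (at y) (- (s *\<^sub>R h)) = - D y * s" for y s
      using lin[of y] by (simp add: D_def linear_neg linear_scale bounded_linear.linear)
    moreover have "(*) (- D y) = (\<lambda>s. - D y * s)" for y
      by (simp add: fun_eq_iff)
    ultimately show ?thesis
      by (simp only: has_field_derivative_def)
  qed
  \<comment> \<open>This bounds the difference quotients in t by B, so that B times the indicator of
    C dominates them when g is differentiated under the integral.\<close>
  have lip: "\<bar>\<phi> (x - s *\<^sub>R h) - \<phi> (x - t *\<^sub>R h)\<bar> \<le> B * \<bar>s - t\<bar>" for x s t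
    using field_differentiable_bound[of UNIV "\<lambda>t. \<phi> (x - t *\<^sub>R h)" "\<lambda>t. - D (x - t *\<^sub>R h)" B s t] line B
    by simp
  have int_\<phi>: "integrable lborel (\<lambda>x. indicat_real C x * \<phi> (x - t *\<^sub>R h))" for t
    by (rule Bochner_Integration.integrable_bound[OF fin]) (use \<phi>(3) in \<open>auto simp: indicator_def\<close>)
  have deriv: "(g has_real_derivative g' t) (at t)" for t
    unfolding DERIV_def
  proof (subst tendsto_at_iff_sequentially, intro allI impI)
    fix X :: "nat \<Rightarrow> real"
    assume X: "\<forall>i. X i \<in> UNIV - {0}" "X \<longlonglongrightarrow> 0"
    have X0: "X i \<noteq> 0" for i using X(1) by auto
    have quot: "(g (t + X i) - g t) / X i
        = (LINT x|lborel. indicat_real C x * ((\<phi> (x - (t + X i) *\<^sub>R h) - \<phi> (x - t *\<^sub>R h)) / X i))" for i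
    proof -
      have "(g (t + X i) - g t) / X i
        = (LINT x|lborel. (indicat_real C x * \<phi> (x - (t + X i) *\<^sub>R h) - indicat_real C x * \<phi> (x - t *\<^sub>R h)) / X i)"
        unfolding g_def using int_\<phi> by simp
      then show ?thesis by (simp add: right_diff_distrib)
    qed
    have "(\<lambda>i. LINT x|lborel. indicat_real C x * ((\<phi> (x - (t + X i) *\<^sub>R h) - \<phi> (x - t *\<^sub>R h)) / X i))
        \<longlonglongrightarrow> (LINT x|lborel. indicat_real C x * - D (x - t *\<^sub>R h))"
    proof (rule integral_dominated_convergence[where w = "\<lambda>x. B * indicat_real C x"])
      show "AE x in lborel. (\<lambda>i. indicat_real C x * ((\<phi> (x - (t + X i) *\<^sub>R h) - \<phi> (x - t *\<^sub>R h)) / X i))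
          \<longlonglongrightarrow> indicat_real C x * - D (x - t *\<^sub>R h)"
      proof (rule AE_I2)
        fix x
        have "((\<lambda>k. (\<phi> (x - (t + k) *\<^sub>R h) - \<phi> (x - t *\<^sub>R h)) / k) \<longlongrightarrow> - D (x - t *\<^sub>R h)) (at 0)"
          using line[of x t UNIV] by (simp add: DERIV_def)
        then have "(\<lambda>i. (\<phi> (x - (t + X i) *\<^sub>R h) - \<phi> (x - t *\<^sub>R h)) / X i) \<longlonglongrightarrow> - D (x - t *\<^sub>R h)"
          unfolding tendsto_at_iff_sequentially comp_def using X by blast
        then show "(\<lambda>i. indicat_real C x * ((\<phi> (x - (t + X i) *\<^sub>R h) - \<phi> (x - t *\<^sub>R h)) / X i))
            \<longlonglongrightarrow> indicat_real C x * - D (x - t *\<^sub>R h)"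
          by (rule tendsto_mult_left)
      qed
      show "AE x in lborel. norm (indicat_real C x * ((\<phi> (x - (t + X i) *\<^sub>R h) - \<phi> (x - t *\<^sub>R h)) / X i))
          \<le> B * indicat_real C x" for i
        using lip[of _ "t + X i" t] X0[of i] by (intro AE_I2) (auto simp: indicator_def field_simps)
    qed (use fin in auto)
    then show "((\<lambda>k. (g (t + k) - g t) / k) \<circ> X) \<longlonglongrightarrow> g' t"
      by (simp add: comp_def quot g'_def)
  qed
  have g'_bound: "\<bar>g' t\<bar> \<le> norm h * M" for t
  proof (cases "h = 0")
    case True
    then have "D x = 0" for x
      using lin[of x] by (simp add: D_def linear_0 bounded_linear.linear)
    then show ?thesis using True by (simp add: g'_def)
  next
    case False
    \<comment> \<open>Only fields of norm at most 1 may be tested, hence the unit direction h / |h|.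
      The divergence is then the derivative of \<phi> along h divided by |h|, and this quotient is
      the source of the factor \<open>norm h\<close>.\<close>
    define \<Phi> where "\<Phi> x = \<phi> (x + - (t *\<^sub>R h)) *\<^sub>R ((1 / norm h) *\<^sub>R h)" for x
    have bl: "bounded_linear (\<lambda>s. s *\<^sub>R ((1 / norm h) *\<^sub>R h))"
      by (rule bounded_linear_scaleR_left)
    have smooth: "smooth \<Phi>"
      unfolding smooth_def \<Phi>_def
      using \<phi>(1) by (intro allI C_class_bounded_linear_compose[OF bl] C_class_shift) (simp only: smooth_def)
    have "{x. \<Phi> x \<noteq> 0} \<subseteq> (+) (t *\<^sub>R h) ` {x. \<phi> x \<noteq> 0}"
    proof
      fix x assume "x \<in> {x. \<Phi> x \<noteq> 0}"
      then have "\<phi> (x + - (t *\<^sub>R h)) \<noteq> 0" by (auto simp: \<Phi>_def)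
      then show "x \<in> (+) (t *\<^sub>R h) ` {x. \<phi> x \<noteq> 0}"
        by (intro image_eqI[of _ _ "x + - (t *\<^sub>R h)"]) auto
    qed
    then have bdd: "bounded {x. \<Phi> x \<noteq> 0}"
      using bounded_translation[OF \<phi>(2)] bounded_subset by blast
    have norm: "norm (\<Phi> x) \<le> 1" for x
      using False \<phi>(3) by (simp add: \<Phi>_def)
    have "divergence \<Phi> x = D (x - t *\<^sub>R h) / norm h" for x
    proof -
      have "((\<lambda>x. x + - (t *\<^sub>R h)) has_derivative (\<lambda>s. s)) (at x)"
        by (auto intro!: derivative_eq_intros)
      from bounded_linear.has_derivative[OF bl has_derivative_compose[OF this der]]
      have "frechet_derivative \<Phi> (at x) = (\<lambda>s. frechet_derivative \<phi> (at (x - t *\<^sub>R h)) s *\<^sub>R ((1 / norm h) *\<^sub>R h))"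
        by (intro frechet_derivative_at[symmetric]) (simp add: \<Phi>_def[abs_def])
      then have "divergence \<Phi> x = (\<Sum>b\<in>Basis. (h \<bullet> b) * frechet_derivative \<phi> (at (x - t *\<^sub>R h)) b) / norm h"
        by (simp add: divergence_def sum_divide_distrib mult_ac)
      also have "(\<Sum>b\<in>Basis. (h \<bullet> b) * frechet_derivative \<phi> (at (x - t *\<^sub>R h)) b) = D (x - t *\<^sub>R h)"
      proof -
        note l = bounded_linear.linear[OF lin[of "x - t *\<^sub>R h"]]
        have "D (x - t *\<^sub>R h) = frechet_derivative \<phi> (at (x - t *\<^sub>R h)) (\<Sum>b\<in>Basis. (h \<bullet> b) *\<^sub>R b)"
          by (simp add: D_def euclidean_representation)
        then show ?thesis
          by (simp add: linear_sum[OF l] linear_scale[OF l])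
      qed
      finally show ?thesis .
    qed
    then have "(LINT x|lebesgue. indicator C x * divergence \<Phi> x) = (LINT x|lebesgue. indicator C x * D (x - t *\<^sub>R h) / norm h)"
      by simp
    also have "\<dots> = (LINT x|lborel. indicator C x * D (x - t *\<^sub>R h) / norm h)"
      by (rule integral_completion) measurable
    also have "\<dots> = - g' t / norm h"
      by (simp add: g'_def)
    finally have "\<bar>g' t / norm h\<bar> \<le> M"
      using distr_grad_le[OF tv smooth bdd norm] by simp
    then show ?thesis
      using False by (simp add: field_simps)
  qed
  have "\<bar>g 1 - g 0\<bar> \<le> norm h * M * norm (1 - 0 :: real)"
    using field_differentiable_bound[of UNIV g g' "norm h * M" 1 0] deriv g'_bound by simp
  then show ?thesis by (simp add: g_def)
qed

text \<open>A change of variables moves the translation from the set to the test function. Thus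
  \<open>translation_test\<close> bounds every smooth pairing with the difference of the indicators,
  and duality bounds its L1 norm.\<close>

lemma translation_estimate:
  fixes C :: "'a::euclidean_space set"
  assumes C: "C \<in> sets borel" "bounded C"
    and tv: "total_variation (distr_grad (indicator C)) \<le> ennreal M" "M \<ge> 0"
  shows "(\<integral>\<^sup>+x. ennreal \<bar>indicat_real C (x + h) - indicat_real C x\<bar> \<partial>lborel) \<le> ennreal (norm h * M)"
proof -
  define A where "A = (\<lambda>x. x + h) -` C"
  have A: "A \<in> sets borel" "bounded A"
  proof -
    have "(\<lambda>x. x + h) -` C \<inter> space borel \<in> sets borel"
      by (rule measurable_sets[OF _ C(1)]) simp
    then show "A \<in> sets borel" by (simp add: A_def)
    have "A \<subseteq> (+) (- h) ` C"
    proof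
      fix x assume "x \<in> A"
      then show "x \<in> (+) (- h) ` C" by (intro image_eqI[of _ _ "x + h"]) (auto simp: A_def)
    qed
    then show "bounded A"
      using bounded_translation[OF C(2)] bounded_subset by blast
  qed
  note fin = integrable_indicator_bounded
  have "measure lborel (A - C) + measure lborel (C - A) \<le> norm h * M"
  proof (rule L1_norm_duality_sets[OF A C])
    fix \<phi> :: "'a \<Rightarrow> real" assume \<phi>: "smooth \<phi>" "bounded {x. \<phi> x \<noteq> 0}" "\<And>x. \<bar>\<phi> x\<bar> \<le> 1"
    have \<phi>m[measurable]: "\<phi> \<in> borel_measurable borel"
      using \<phi>(1) C_class.simps(1)[of \<phi>] unfolding smooth_def by (metis borel_measurable_continuous_onI)
    have [measurable]: "C \<in> sets borel" "A \<in> sets borel" by fact+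
    have int: "integrable lborel (\<lambda>x. indicat_real X x * \<phi> x)" if "X \<in> sets borel" "bounded X" for X
      by (rule Bochner_Integration.integrable_bound[OF fin[OF that]]) (use \<phi>(3) that in \<open>auto simp: indicator_def\<close>)
    have "(LINT x|lborel. indicat_real C x * \<phi> (x - h)) = (LINT x|lborel. indicat_real C (h + x) * \<phi> (h + x - h))"
      by (rule lborel_integral_shift[symmetric]) measurable
    also have "\<dots> = (LINT x|lborel. indicat_real A x * \<phi> x)"
      by (rule Bochner_Integration.integral_cong) (auto simp: A_def indicator_def add.commute)
    finally have "(LINT x|lborel. (indicat_real A x - indicat_real C x) * \<phi> x)
        = (LINT x|lborel. indicat_real C x * \<phi> (x - h)) - (LINT x|lborel. indicat_real C x * \<phi> x)"
      using int[OF A] int[OF C] by (simp add: left_diff_distrib)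
    then show "\<bar>LINT x|lborel. (indicat_real A x - indicat_real C x) * \<phi> x\<bar> \<le> norm h * M"
      using translation_test[OF C tv \<phi>] by simp
  qed
  then have le: "ennreal (measure lborel (A - C) + measure lborel (C - A)) \<le> ennreal (norm h * M)"
    by (rule ennreal_leI)
  have "(\<integral>\<^sup>+x. ennreal \<bar>indicat_real C (x + h) - indicat_real C x\<bar> \<partial>lborel)
      = (\<integral>\<^sup>+x. indicator (A - C) x + indicator (C - A) x \<partial>lborel)"
    by (rule nn_integral_cong) (auto simp: A_def indicator_def)
  also have "\<dots> = emeasure lborel (A - C) + emeasure lborel (C - A)"
    using A C by (subst nn_integral_add) auto
  also have "\<dots> = ennreal (measure lborel (A - C) + measure lborel (C - A))"
  proof -
    have "emeasure lborel X = ennreal (measure lborel X)" if "bounded X" for X :: "'a set"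
      using emeasure_bounded_finite[OF that] by (simp add: emeasure_eq_ennreal_measure less_top)
    then show ?thesis
      using A C by (simp add: bounded_subset[of A "A - C"] bounded_subset[of C "C - A"])
  qed
  also note le
  finally show ?thesis .
qed

section \<open>Compactness of sets of bounded perimeter\<close>

text \<open>Completeness of L1 in a form that keeps the subsequence converging almost everywhere.
  Fatou's lemma, applied to the distance of s i to s (r j) as j grows, gives both the integrability
  of the limit and the convergence in norm.\<close>

lemma L1_Cauchy_convergent_subseq:
  fixes s :: "nat \<Rightarrow> 'a \<Rightarrow> 'b::{banach, second_countable_topology}"
  assumes int: "\<And>n. integrable M (s n)"
    and Cauchy: "\<And>e. e > 0 \<Longrightarrow> \<exists>N. \<forall>i\<ge>N. \<forall>j\<ge>N. (LINT x|M. norm (s i x - s j x)) < e"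
  obtains r f where "strict_mono r" "integrable M f" "AE x in M. (\<lambda>i. s (r i) x) \<longlonglongrightarrow> f x"
    "(\<lambda>i. LINT x|M. norm (s (r i) x - f x)) \<longlonglongrightarrow> 0"
proof -
  obtain r where r: "strict_mono r" and ae: "AE x in M. Cauchy (\<lambda>i. s (r i) x)"
    using cauchy_L1_AE_cauchy_subseq[of M s] assms by blast
  have [measurable]: "s n \<in> borel_measurable M" for n
    using int by auto
  define f where "f = (\<lambda>x. lim (\<lambda>i. s (r i) x))"
  have f[measurable]: "f \<in> borel_measurable M"
    unfolding f_def by measurable
  have lim: "AE x in M. (\<lambda>i. s (r i) x) \<longlonglongrightarrow> f x"
    using ae by eventually_elim (simp add: f_def Cauchy_convergent_iff convergent_LIMSEQ_iff)
  have Fatou: "(\<integral>\<^sup>+x. norm (s i x - f x) \<partial>M) \<le> ennreal e"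
    if e: "\<And>j. j \<ge> N \<Longrightarrow> (LINT x|M. norm (s i x - s j x)) < e" for i e N
  proof -
    have "(\<integral>\<^sup>+x. norm (s i x - f x) \<partial>M) = (\<integral>\<^sup>+x. liminf (\<lambda>j. ennreal (norm (s i x - s (r j) x))) \<partial>M)"
    proof (rule nn_integral_cong_AE)
      show "AE x in M. ennreal (norm (s i x - f x)) = liminf (\<lambda>j. ennreal (norm (s i x - s (r j) x)))"
        using lim
      proof eventually_elim
        case (elim x)
        then have "(\<lambda>j. ennreal (norm (s i x - s (r j) x))) \<longlonglongrightarrow> ennreal (norm (s i x - f x))"
          by (intro tendsto_intros)
        then show ?case
          by (rule lim_imp_Liminf[OF sequentially_bot, symmetric])
      qed
    qed
    also have "\<dots> \<le> liminf (\<lambda>j. \<integral>\<^sup>+x. norm (s i x - s (r j) x) \<partial>M)"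
      by (rule nn_integral_liminf) simp
    also have "\<dots> \<le> liminf (\<lambda>j. ennreal e)"
    proof (rule Liminf_mono)
      show "eventually (\<lambda>j. (\<integral>\<^sup>+x. norm (s i x - s (r j) x) \<partial>M) \<le> ennreal e) sequentially"
        using eventually_ge_at_top[of N]
      proof eventually_elim
        case (elim j)
        have "r j \<ge> N"
          using seq_suble[OF r, of j] elim by linarith
        then show ?case
          using e[of "r j"] int by (subst nn_integral_eq_integral) (auto intro!: ennreal_leI)
      qed
    qed
    also have "\<dots> = ennreal e"
      by (simp add: Liminf_const)
    finally show ?thesis .
  qed
  obtain N1 where N1: "\<And>i j. i \<ge> N1 \<Longrightarrow> j \<ge> N1 \<Longrightarrow> (LINT x|M. norm (s i x - s j x)) < 1"
    using Cauchy[of 1] by auto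
  have "(\<integral>\<^sup>+x. norm (s N1 x - f x) \<partial>M) < \<infinity>"
    using Fatou[of N1 N1 1] N1 by (auto simp: le_less_trans)
  then have "integrable M (\<lambda>x. s N1 x - f x)"
    by (simp add: integrable_iff_bounded)
  then have "integrable M (\<lambda>x. s N1 x - (s N1 x - f x))"
    by (rule Bochner_Integration.integrable_diff[OF int])
  then have f_int: "integrable M f"
    by simp
  have "(\<lambda>i. LINT x|M. norm (s (r i) x - f x)) \<longlonglongrightarrow> 0"
  proof (rule LIMSEQ_I)
    fix e :: real assume "e > 0"
    then obtain N where N: "\<And>i j. i \<ge> N \<Longrightarrow> j \<ge> N \<Longrightarrow> (LINT x|M. norm (s i x - s j x)) < e / 2"
      using Cauchy[of "e / 2"] by auto
    have "norm ((LINT x|M. norm (s (r i) x - f x)) - 0) < e" if "i \<ge> N" for i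
    proof -
      have "r i \<ge> N"
        using seq_suble[OF r, of i] that by linarith
      then have "(\<integral>\<^sup>+x. norm (s (r i) x - f x) \<partial>M) \<le> ennreal (e / 2)"
        using N by (intro Fatou[of N])
      then have "(LINT x|M. norm (s (r i) x - f x)) \<le> e / 2"
        using int f_int \<open>e > 0\<close> by (subst (asm) nn_integral_eq_integral) auto
      then show ?thesis
        using \<open>e > 0\<close> by simp
    qed
    then show "\<exists>N. \<forall>i\<ge>N. norm ((LINT x|M. norm (s (r i) x - f x)) - 0) < e"
      by blast
  qed
  with r f_int lim show thesis
    using that by blast
qed

text \<open>Divided by the volume of the ball, this is the convolution of the indicator of C with
  the uniform kernel on \<open>ball 0 r\<close>, that is, the average of the indicator over
  \<open>ball x r\<close>.\<close>

definition ball_mass :: "'a::euclidean_space set \<Rightarrow> real \<Rightarrow> 'a \<Rightarrow> real" where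
  "ball_mass C r x = (LINT y|lborel. indicat_real (ball x r) y * indicat_real C y)"

text \<open>The domain of integration no longer depends on x, which gives measurability in x and the
  comparison with translates.\<close>

lemma ball_mass_shift:
  assumes [measurable]: "C \<in> sets borel"
  shows "ball_mass C r x = (LINT h|lborel. indicat_real (ball 0 r) h * indicat_real C (x + h))"
proof -
  have [measurable]: "ball x r \<in> sets borel" by simp
  have "ball_mass C r x = (LINT h|lborel. indicat_real (ball x r) (x + h) * indicat_real C (x + h))"
    unfolding ball_mass_def by (rule lborel_integral_shift[symmetric]) measurable
  also have "\<dots> = (LINT h|lborel. indicat_real (ball 0 r) h * indicat_real C (x + h))"
    by (rule Bochner_Integration.integral_cong) (auto simp: indicator_def dist_norm)
  finally show ?thesis .
qed

lemma borel_measurable_ball_mass [measurable]: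
  fixes C :: "'a::euclidean_space set"
  assumes [measurable]: "C \<in> sets borel"
  shows "ball_mass C r \<in> borel_measurable borel"
proof -
  have [measurable]: "ball (0::'a) r \<in> sets borel" by simp
  have "(\<lambda>x. LINT h|lborel. indicat_real (ball 0 r) h * indicat_real C (x + h)) \<in> borel_measurable borel"
    by (rule lborel.borel_measurable_lebesgue_integral) measurable
  then show ?thesis
    unfolding ball_mass_shift[OF assms, abs_def] .
qed

text \<open>
  The difference to the average over balls is an average of the translation differences,
  which \<open>translation_estimate\<close> bounds.
\<close>

lemma average_estimate:
  fixes C :: "'a::euclidean_space set"
  assumes C: "C \<in> sets borel" "bounded C"
    and tv: "total_variation (distr_grad (indicator C)) \<le> ennreal M" "M \<ge> 0" and "r > 0"
  defines "V \<equiv> measure lborel (ball (0::'a) r)"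
  shows "integrable lborel (\<lambda>x. indicat_real C x - ball_mass C r x / V)"
    and "(LINT x|lborel. \<bar>indicat_real C x - ball_mass C r x / V\<bar>) \<le> r * M"
proof -
  have [measurable]: "C \<in> sets borel" by fact
  have [measurable]: "ball (0::'a) r \<in> sets borel" by simp
  have V: "V > 0" using \<open>r > 0\<close> by (simp add: V_def content_ball_pos)
  have emV: "emeasure lborel (ball (0::'a) r) = ennreal V"
    unfolding V_def using emeasure_bounded_finite[OF bounded_ball, of "0::'a" r]
    by (intro emeasure_eq_ennreal_measure) auto
  let ?f = "\<lambda>x. \<bar>indicat_real C x - ball_mass C r x / V\<bar>"
  let ?B = "ball (0::'a) r"
  have B: "integrable lborel (indicat_real ?B)"
    by (rule integrable_indicator_bounded) auto
  have pw: "ennreal (V * ?f x) \<le> (\<integral>\<^sup>+h. indicator ?B h * ennreal \<bar>indicat_real C (x + h) - indicat_real C x\<bar> \<partial>lborel)" for x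
  proof -
    have int: "integrable lborel (\<lambda>h. indicat_real ?B h * indicat_real C (x + h))"
      by (rule Bochner_Integration.integrable_bound[OF B]) (auto simp: indicator_def)
    have "V * ?f x = \<bar>V * (indicat_real C x - ball_mass C r x / V)\<bar>"
      using V by (simp add: abs_mult)
    also have "\<dots> = \<bar>V * indicat_real C x - ball_mass C r x\<bar>"
      using V by (simp add: right_diff_distrib)
    also have "\<dots> = \<bar>LINT h|lborel. indicat_real ?B h * indicat_real C (x + h) - indicat_real C x * indicat_real ?B h\<bar>"
      using int B unfolding ball_mass_shift[OF C(1)] by (simp add: V_def abs_minus_commute mult.commute)
    also have "ennreal \<dots> \<le> (\<integral>\<^sup>+h. ennreal (norm (indicat_real ?B h * indicat_real C (x + h) - indicat_real C x * indicat_real ?B h)) \<partial>lborel)"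
      using int B by (subst real_norm_def[symmetric], intro integral_norm_bound_ennreal) auto
    also have "\<dots> = (\<integral>\<^sup>+h. indicator ?B h * ennreal \<bar>indicat_real C (x + h) - indicat_real C x\<bar> \<partial>lborel)"
      by (rule nn_integral_cong) (auto simp: indicator_def)
    finally show ?thesis .
  qed
  \<comment> \<open>The computation stays with nonnegative integrals because the integrability of
    the difference is itself one of its conclusions. Multiplying by V avoids a division before the
    order of integration is exchanged.\<close>
  have "ennreal V * (\<integral>\<^sup>+x. ennreal (?f x) \<partial>lborel) = (\<integral>\<^sup>+x. ennreal (V * ?f x) \<partial>lborel)"
    using V by (subst nn_integral_cmult[symmetric]) (auto simp: ennreal_mult)
  also have "\<dots> \<le> (\<integral>\<^sup>+x. (\<integral>\<^sup>+h. indicator ?B h * ennreal \<bar>indicat_real C (x + h) - indicat_real C x\<bar> \<partial>lborel) \<partial>lborel)"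
    by (intro nn_integral_mono pw)
  also have "\<dots> = (\<integral>\<^sup>+h. (\<integral>\<^sup>+x. indicator ?B h * ennreal \<bar>indicat_real C (x + h) - indicat_real C x\<bar> \<partial>lborel) \<partial>lborel)"
    by (rule lborel_pair.Fubini') measurable
  also have "\<dots> \<le> (\<integral>\<^sup>+h. ennreal (r * M) * indicator ?B h \<partial>lborel)"
  proof (rule nn_integral_mono)
    fix h :: 'a
    have "(\<integral>\<^sup>+x. indicator ?B h * ennreal \<bar>indicat_real C (x + h) - indicat_real C x\<bar> \<partial>lborel)
        = indicator ?B h * (\<integral>\<^sup>+x. ennreal \<bar>indicat_real C (x + h) - indicat_real C x\<bar> \<partial>lborel)"
      by (rule nn_integral_cmult) measurable
    also have "\<dots> \<le> indicator ?B h * ennreal (r * M)"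
    proof (cases "h \<in> ?B")
      case True
      then have "norm h * M \<le> r * M"
        using tv(2) by (intro mult_right_mono) auto
      then have "(\<integral>\<^sup>+x. ennreal \<bar>indicat_real C (x + h) - indicat_real C x\<bar> \<partial>lborel) \<le> ennreal (r * M)"
        using order_trans[OF translation_estimate[OF C tv, of h] ennreal_leI] by blast
      then show ?thesis
        by (rule mult_left_mono) simp
    qed simp
    finally show "(\<integral>\<^sup>+x. indicator ?B h * ennreal \<bar>indicat_real C (x + h) - indicat_real C x\<bar> \<partial>lborel)
        \<le> ennreal (r * M) * indicator ?B h"
      by (simp add: mult.commute)
  qed
  also have "\<dots> = ennreal V * ennreal (r * M)"
    by (subst nn_integral_cmult_indicator) (auto simp: emV mult.commute)
  finally have le: "(\<integral>\<^sup>+x. ennreal (?f x) \<partial>lborel) \<le> ennreal (r * M)"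
    using V by (simp add: ennreal_mult_le_mult_iff)
  then have fin: "(\<integral>\<^sup>+x. ennreal (?f x) \<partial>lborel) < \<infinity>"
    by (rule le_less_trans) simp
  then show int: "integrable lborel (\<lambda>x. indicat_real C x - ball_mass C r x / V)"
    by (simp add: integrable_iff_bounded)
  have "ennreal (LINT x|lborel. ?f x) \<le> ennreal (r * M)"
    using le int by (subst (asm) nn_integral_eq_integral) auto
  then show "(LINT x|lborel. ?f x) \<le> r * M"
    using \<open>r > 0\<close> tv(2) by (subst (asm) ennreal_le_iff) auto
qed

text \<open>The indicators of the moving balls converge off the sphere, which is a null set. Since
  all centres are within distance 1 of x, \<open>ball x (r + 1)\<close> dominates.\<close>

lemma ball_indicator_L1_continuous:
  fixes x :: "'a::euclidean_space"
  assumes "\<And>i::nat. dist (q i) x < 1 / Suc i" "r > 0"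
  shows "(\<lambda>i. LINT y|lborel. \<bar>indicat_real (ball (q i) r) y - indicat_real (ball x r) y\<bar>) \<longlonglongrightarrow> 0"
proof -
  have "sphere x r \<in> null_sets lebesgue"
    using negligible_sphere negligible_iff_null_sets by blast
  then have "sphere x r \<in> null_sets lborel"
    by (simp add: null_sets_completion_iff)
  then have ae: "AE y in lborel. y \<notin> sphere x r"
    by (rule AE_not_in)
  have q: "q \<longlonglongrightarrow> x"
  proof (subst tendsto_dist_iff, rule Lim_null_comparison)
    show "\<forall>\<^sub>F i in sequentially. norm (dist (q i) x) \<le> 1 / real (Suc i)"
      using assms(1) by (auto intro!: always_eventually less_imp_le)
    show "(\<lambda>i. 1 / real (Suc i)) \<longlonglongrightarrow> 0"
      by (rule LIMSEQ_Suc[OF lim_1_over_n])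
  qed
  have "(\<lambda>i. LINT y|lborel. \<bar>indicat_real (ball (q i) r) y - indicat_real (ball x r) y\<bar>)
      \<longlonglongrightarrow> (LINT y|(lborel :: 'a measure). (0::real))"
  proof (rule integral_dominated_convergence[where w = "indicat_real (ball x (r + 1) :: 'a set)"])
    show "AE y in lborel. (\<lambda>i. \<bar>indicat_real (ball (q i) r) y - indicat_real (ball x r) y\<bar>) \<longlonglongrightarrow> 0"
      using ae
    proof eventually_elim
      case (elim y)
      have d: "(\<lambda>i. dist (q i) y) \<longlonglongrightarrow> dist x y"
        using q by (intro tendsto_intros)
      have "\<forall>\<^sub>F i in sequentially. y \<in> ball (q i) r \<longleftrightarrow> y \<in> ball x r"
      proof (cases "dist x y < r")
        case True
        from order_tendstoD(2)[OF d this] show ?thesis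
          by eventually_elim (use True in auto)
      next
        case False
        then have "r < dist x y" using elim by auto
        from order_tendstoD(1)[OF d this] show ?thesis
          by eventually_elim (use False in auto)
      qed
      then show ?case
        by (intro tendsto_eventually) (auto elim!: eventually_mono simp: indicator_def)
    qed
    show "AE y in lborel. norm \<bar>indicat_real (ball (q i) r) y - indicat_real (ball x r) y\<bar> \<le> indicat_real (ball x (r + 1)) y" for i
    proof (rule AE_I2)
      fix y
      have "dist (q i) x < 1"
        using assms(1)[of i] by (rule less_le_trans) simp
      then have "dist x y < r + 1" if "dist (q i) y < r"
        using that dist_triangle[of x y "q i"] by (simp add: dist_commute)
      then show "norm \<bar>indicat_real (ball (q i) r) y - indicat_real (ball x r) y\<bar> \<le> indicat_real (ball x (r + 1)) y"
        by (auto simp: indicator_def)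
    qed
  qed (auto intro!: integrable_indicator_bounded borel_measurable_abs borel_measurable_diff borel_measurable_indicator)
  then show ?thesis by simp
qed

text \<open>The Frechet-Kolmogorov argument. By \<open>average_estimate\<close> each set is within
  \<rho> M in L1 of its averages at radius \<rho>, uniformly along the sequence. So it suffices
  that, for one subsequence, the averages converge in L1 at every radius \<rho> j; pointwise
  convergence and a common dominating function give that.\<close>

lemma BV_sets_L1_compact_borel:
  fixes C :: "nat \<Rightarrow> 'a::euclidean_space set"
  assumes C: "\<And>n. C n \<in> sets borel" "\<And>n. C n \<subseteq> ball 0 R"
    and tv: "\<And>n. total_variation (distr_grad (indicator (C n))) \<le> ennreal M" and M: "M \<ge> 0"
  obtains k where "strict_mono (k :: nat \<Rightarrow> nat)"
    "\<forall>e>0. \<exists>N. \<forall>i\<ge>N. \<forall>j\<ge>N. (LINT x|lborel. norm (indicat_real (C (k i)) x - indicat_real (C (k j)) x)) < e"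
proof -
  have [measurable]: "C n \<in> sets borel" for n by (rule C)
  have Cb: "bounded (C n)" for n
    using C(2) bounded_ball bounded_subset by blast
  define W where "W = measure lborel (ball (0::'a) R)"
  define \<rho> where "\<rho> j = 1 / real (Suc j)" for j
  have \<rho>: "\<rho> j > 0" "\<rho> j \<le> 1" for j by (simp_all add: \<rho>_def)
  define a where "a n z = ball_mass (C n) (\<rho> (snd z)) (fst z)" for n z
  have intW: "integrable lborel (indicat_real (ball (0::'a) R))" and Wint: "W = (LINT x|lborel. indicat_real (ball (0::'a) R) x)"
    using integrable_indicator_bounded[of "ball (0::'a) R"] by (auto simp: W_def)
  have mass_int: "integrable lborel (\<lambda>y. indicat_real (ball x r) y * indicat_real (C n) y)" for x r n
    by (rule Bochner_Integration.integrable_bound[OF integrable_indicator_bounded[OF C(1) Cb]])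
      (auto simp: indicator_def)
  have mass: "0 \<le> ball_mass (C n) r x" "ball_mass (C n) r x \<le> W" for n r x
  proof -
    show "0 \<le> ball_mass (C n) r x"
      unfolding ball_mass_def by (rule integral_nonneg_AE) auto
    show "ball_mass (C n) r x \<le> W"
      unfolding ball_mass_def Wint using mass_int intW
      by (rule integral_mono) (use C(2)[of n] in \<open>auto simp: indicator_def\<close>)
  qed
  obtain D :: "'a set" where D: "countable D" "\<And>X. open X \<Longrightarrow> X \<noteq> {} \<Longrightarrow> \<exists>d\<in>D. d \<in> X"
    using countable_dense_setE by blast
  have "countable (D \<times> (UNIV :: nat set))"
    using D(1) by auto
  \<comment> \<open>The diagonal argument over the countable set of pairs of a centre in the dense
    set D and the index of a radius.\<close>
  then obtain k where k: "strict_mono k" "\<And>z. z \<in> D \<times> UNIV \<Longrightarrow> \<exists>l. (\<lambda>n. a (k n) z) \<longlonglongrightarrow> l"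
    by (rule function_convergent_subsequence[where f = a and M = W])
      (use mass in \<open>simp_all add: a_def\<close>)
  have conv: "convergent (\<lambda>n. ball_mass (C (k n)) (\<rho> j) x)" for x j
  proof -
    have "Cauchy (\<lambda>n. ball_mass (C (k n)) (\<rho> j) x)"
    proof (rule CauchyI)
      fix e :: real assume "e > 0"
      have "\<exists>d\<in>D. dist d x < 1 / Suc i" for i
        using D(2)[of "ball x (1 / Suc i)"] by (auto simp: dist_commute)
      then obtain q where q: "\<And>i. q i \<in> D" "\<And>i. dist (q i) x < 1 / Suc i"
        by metis
      have "\<forall>\<^sub>F i in sequentially. (LINT y|lborel. \<bar>indicat_real (ball (q i) (\<rho> j)) y - indicat_real (ball x (\<rho> j)) y\<bar>) < e / 3"
        using order_tendstoD(2)[OF ball_indicator_L1_continuous[OF q(2) \<rho>(1)], of "e / 3"] \<open>e > 0\<close> by simp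
      then obtain i where i: "(LINT y|lborel. \<bar>indicat_real (ball (q i) (\<rho> j)) y - indicat_real (ball x (\<rho> j)) y\<bar>) < e / 3"
        by (auto simp: eventually_sequentially)
      \<comment> \<open>The bound depends on the two balls but not on n. This equicontinuity carries
        convergence from centres in D to all centres.\<close>
      have close: "\<bar>ball_mass (C n) (\<rho> j) (q i) - ball_mass (C n) (\<rho> j) x\<bar> < e / 3" for n
      proof -
        have ib: "integrable lborel (indicat_real (ball z (\<rho> j)))" for z :: 'a
          by (rule integrable_indicator_bounded) auto
        have "\<bar>ball_mass (C n) (\<rho> j) (q i) - ball_mass (C n) (\<rho> j) x\<bar>
            = norm (LINT y|lborel. indicat_real (ball (q i) (\<rho> j)) y * indicat_real (C n) y
                 - indicat_real (ball x (\<rho> j)) y * indicat_real (C n) y)"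
          unfolding ball_mass_def using mass_int by simp
        also have "\<dots> \<le> (LINT y|lborel. norm (indicat_real (ball (q i) (\<rho> j)) y * indicat_real (C n) y
                 - indicat_real (ball x (\<rho> j)) y * indicat_real (C n) y))"
          by (rule integral_norm_bound)
        also have "\<dots> \<le> (LINT y|lborel. \<bar>indicat_real (ball (q i) (\<rho> j)) y - indicat_real (ball x (\<rho> j)) y\<bar>)"
        proof (rule integral_mono)
          show "integrable lborel (\<lambda>y. norm (indicat_real (ball (q i) (\<rho> j)) y * indicat_real (C n) y
                 - indicat_real (ball x (\<rho> j)) y * indicat_real (C n) y))"
            by (intro integrable_norm Bochner_Integration.integrable_diff mass_int)
          show "integrable lborel (\<lambda>y. \<bar>indicat_real (ball (q i) (\<rho> j)) y - indicat_real (ball x (\<rho> j)) y\<bar>)"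
            by (intro integrable_abs Bochner_Integration.integrable_diff ib)
        qed (auto simp: indicator_def)
        finally show ?thesis using i by simp
      qed
      obtain l where "(\<lambda>n. a (k n) (q i, j)) \<longlonglongrightarrow> l"
        using k(2)[of "(q i, j)"] q(1) by auto
      then have "Cauchy (\<lambda>n. ball_mass (C (k n)) (\<rho> j) (q i))"
        by (intro LIMSEQ_imp_Cauchy[of _ l]) (simp add: a_def)
      then obtain N where N: "\<And>m n. m \<ge> N \<Longrightarrow> n \<ge> N \<Longrightarrow>
          \<bar>ball_mass (C (k m)) (\<rho> j) (q i) - ball_mass (C (k n)) (\<rho> j) (q i)\<bar> < e / 3"
        using \<open>e > 0\<close> CauchyD[of "\<lambda>n. ball_mass (C (k n)) (\<rho> j) (q i)" "e / 3"] by auto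
      have "norm (ball_mass (C (k m)) (\<rho> j) x - ball_mass (C (k n)) (\<rho> j) x) < e" if "m \<ge> N" "n \<ge> N" for m n
      proof -
        have "\<bar>ball_mass (C (k m)) (\<rho> j) x - ball_mass (C (k n)) (\<rho> j) x\<bar> < e / 3 + e / 3 + e / 3"
          using N[OF that] close[of "k m"] close[of "k n"] by linarith
        then show ?thesis by simp
      qed
      then show "\<exists>N. \<forall>m\<ge>N. \<forall>n\<ge>N. norm (ball_mass (C (k m)) (\<rho> j) x - ball_mass (C (k n)) (\<rho> j) x) < e"
        by blast
    qed
    then show ?thesis by (simp add: Cauchy_convergent_iff)
  qed
  define b where "b j x = lim (\<lambda>n. ball_mass (C (k n)) (\<rho> j) x)" for j x
  have b: "(\<lambda>n. ball_mass (C (k n)) (\<rho> j) x) \<longlonglongrightarrow> b j x" for j x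
    using conv by (simp add: b_def convergent_LIMSEQ_iff)
  have bm [measurable]: "b j \<in> borel_measurable borel" for j
    unfolding b_def[abs_def] by measurable
  \<comment> \<open>Radii are at most 1 and the sets lie in \<open>ball 0 R\<close>, so balls
    centred outside \<open>ball 0 (R + 1)\<close> miss them.\<close>
  have bnd: "norm (ball_mass (C n) (\<rho> j) x) \<le> W * indicat_real (ball 0 (R + 1)) x" for n j x
  proof (cases "x \<in> ball 0 (R + 1)")
    case False
    have "indicat_real (ball x (\<rho> j)) y * indicat_real (C n) y = 0" for y
    proof (rule ccontr)
      assume "\<not> ?thesis"
      then have "dist x y < 1" "norm y < R"
        using C(2)[of n] \<rho>(2)[of j] by (auto simp: indicator_def split: if_splits)
      then show False
        using False norm_triangle_ineq4[of "y - x" y] by (simp add: dist_norm norm_minus_commute)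
    qed
    then have "ball_mass (C n) (\<rho> j) x = 0"
      unfolding ball_mass_def by (intro integral_eq_zero_AE AE_I2)
    then show ?thesis using False by simp
  qed (use mass in simp)
  have wint: "integrable lborel (\<lambda>x. W * indicat_real (ball (0::'a) (R + 1)) x)"
    by (intro integrable_mult_right integrable_indicator_bounded) auto
  have mint: "integrable lborel (ball_mass (C n) (\<rho> j))" for n j
  proof (rule Bochner_Integration.integrable_bound[OF wint])
    show "AE x in lborel. norm (ball_mass (C n) (\<rho> j) x) \<le> norm (W * indicat_real (ball 0 (R + 1)) x)"
      using order_trans[OF bnd abs_ge_self] by (intro AE_I2) (simp only: real_norm_def)
  qed simp
  have bint: "integrable lborel (b j)" for j
    by (rule integrable_dominated_convergence[OF _ _ wint, of _ "\<lambda>n. ball_mass (C (k n)) (\<rho> j)"])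
      (use b bnd in auto)
  have L1: "(\<lambda>n. LINT x|lborel. \<bar>ball_mass (C (k n)) (\<rho> j) x - b j x\<bar>) \<longlonglongrightarrow> 0" for j
  proof -
    have "(\<lambda>n. LINT x|lborel. \<bar>ball_mass (C (k n)) (\<rho> j) x - b j x\<bar>) \<longlonglongrightarrow> (LINT x|(lborel :: 'a measure). (0::real))"
      using b bnd
    proof (intro integral_dominated_convergence[where w = "\<lambda>x. W * indicat_real (ball 0 (R + 1)) x + \<bar>b j x\<bar>"] AE_I2)
      show "(\<lambda>i. \<bar>ball_mass (C (k i)) (\<rho> j) x - b j x\<bar>) \<longlonglongrightarrow> 0" for x
        using b[of j x] by (intro tendsto_rabs_zero LIM_zero)
      show "norm \<bar>ball_mass (C (k i)) (\<rho> j) x - b j x\<bar> \<le> W * indicat_real (ball 0 (R + 1)) x + \<bar>b j x\<bar>" for i x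
        using bnd[of "k i" j x] by (auto simp del: indicator_simps)
    qed (use wint bint in auto)
    then show ?thesis by simp
  qed
  show thesis
  proof (rule that[OF k(1)], intro allI impI)
    fix e :: real assume "e > 0"
    \<comment> \<open>The budget is e/4 for each of the two distances of a set to its average, and
      e/2 for the distance of the two averages, which passes through b j. Using M + 1 keeps the
      denominator nonzero when M = 0.\<close>
    obtain j where j: "1 / real (Suc j) < e / (4 * (M + 1))"
      using nat_approx_posE[of "e / (4 * (M + 1))"] \<open>e > 0\<close> M by auto
    have \<rho>M: "\<rho> j * M < e / 4"
    proof -
      have "\<rho> j * M \<le> \<rho> j * (M + 1)" using \<rho>(1)[of j] by simp
      also have "\<dots> < e / (4 * (M + 1)) * (M + 1)"
        using j M by (intro mult_strict_right_mono) (auto simp: \<rho>_def)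
      also have "\<dots> = e / 4"
        using M by (simp add: divide_simps)
      finally show ?thesis .
    qed
    define V where "V = measure lborel (ball (0::'a) (\<rho> j))"
    have V: "V > 0" using \<rho>(1)[of j] by (simp add: V_def content_ball_pos)
    have "\<forall>\<^sub>F n in sequentially. (LINT x|lborel. \<bar>ball_mass (C (k n)) (\<rho> j) x - b j x\<bar>) < V * e / 4"
      using order_tendstoD(2)[OF L1, of "V * e / 4"] V \<open>e > 0\<close> by simp
    then obtain N where N: "\<And>n. n \<ge> N \<Longrightarrow> (LINT x|lborel. \<bar>ball_mass (C (k n)) (\<rho> j) x - b j x\<bar>) < V * e / 4"
      by (auto simp: eventually_sequentially)
    let ?A = "\<lambda>n x. \<bar>indicat_real (C (k n)) x - ball_mass (C (k n)) (\<rho> j) x / V\<bar>"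
    let ?B = "\<lambda>n x. \<bar>ball_mass (C (k n)) (\<rho> j) x - b j x\<bar>"
    note av = average_estimate[OF C(1) Cb tv M \<rho>(1), of _ j, folded V_def]
    have "(LINT x|lborel. norm (indicat_real (C (k m)) x - indicat_real (C (k n)) x)) < e"
      if mn: "m \<ge> N" "n \<ge> N" for m n
    proof -
      have ints: "integrable lborel (?A i)" "integrable lborel (?B i)" for i
        using av(1)[of "k i"] mint bint by auto
      have "(LINT x|lborel. norm (indicat_real (C (k m)) x - indicat_real (C (k n)) x))
          \<le> (LINT x|lborel. ?A m x + ?A n x + (?B m x + ?B n x) / V)"
      proof (rule integral_mono)
        show "integrable lborel (\<lambda>x. norm (indicat_real (C (k m)) x - indicat_real (C (k n)) x))"
          using integrable_indicator_bounded[OF C(1) Cb] by auto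
        show "integrable lborel (\<lambda>x. ?A m x + ?A n x + (?B m x + ?B n x) / V)"
          using ints by auto
        fix x
        have "\<bar>ball_mass (C (k m)) (\<rho> j) x / V - ball_mass (C (k n)) (\<rho> j) x / V\<bar> \<le> (?B m x + ?B n x) / V"
          unfolding diff_divide_distrib[symmetric] abs_divide using V by (simp add: divide_right_mono)
        then show "norm (indicat_real (C (k m)) x - indicat_real (C (k n)) x) \<le> ?A m x + ?A n x + (?B m x + ?B n x) / V"
          unfolding real_norm_def by linarith
      qed
      also have "\<dots> = (LINT x|lborel. ?A m x) + (LINT x|lborel. ?A n x)
          + ((LINT x|lborel. ?B m x) + (LINT x|lborel. ?B n x)) / V"
        using ints by simp
      also have "\<dots> < e"
      proof -
        have "(LINT x|lborel. ?B m x) + (LINT x|lborel. ?B n x) < V * (e / 2)"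
          using N[OF mn(1)] N[OF mn(2)] by simp
        then have "((LINT x|lborel. ?B m x) + (LINT x|lborel. ?B n x)) / V < e / 2"
          using V by (simp add: divide_less_eq mult.commute)
        then show ?thesis
          using av(2)[of "k m"] av(2)[of "k n"] \<rho>M by linarith
      qed
      finally show ?thesis .
    qed
    then show "\<exists>N. \<forall>i\<ge>N. \<forall>j\<ge>N. (LINT x|lborel. norm (indicat_real (C (k i)) x - indicat_real (C (k j)) x)) < e"
      by blast
  qed
qed

text \<open>This links the Lebesgue measurable sets of the problem to the estimates above, which are
  stated for Borel sets and \<open>lborel\<close>. Approximating from inside keeps the Borel set in
  the same bounded region.\<close>

lemma lebesgue_set_almost_borel_subset:
  assumes "C \<in> sets lebesgue"
  obtains B where "B \<in> sets borel" "B \<subseteq> C" "AE x in lebesgue. x \<in> B \<longleftrightarrow> x \<in> C"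
proof -
  obtain B T where BT: "fsigma B" "T \<in> null_sets lebesgue" "B \<union> T = C" "disjnt B T"
    using lebesgue_set_almost_fsigma[OF assms] by blast
  have "AE x in lebesgue. x \<notin> T"
    using BT(2) by (rule AE_not_in)
  then have "AE x in lebesgue. x \<in> B \<longleftrightarrow> x \<in> C"
    by eventually_elim (use BT(3) in blast)
  moreover have "B \<in> sets borel"
    using BT(1) by (auto elim!: fsigma.cases)
  ultimately show thesis
    using that BT(3) by blast
qed

lemma test_field_divergence:
  fixes \<phi> :: "'a::euclidean_space \<Rightarrow> 'a"
  assumes "\<phi> \<in> test_fields"
  shows "divergence \<phi> \<in> borel_measurable lebesgue" "\<exists>B. \<forall>x. \<bar>divergence \<phi> x\<bar> \<le> B"
proof -
  have \<phi>: "smooth \<phi>" "bounded {x. \<phi> x \<noteq> 0}"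
    using assms bounded_subset[OF compact_imp_bounded closure_subset] by (auto simp: test_fields_def)
  have "continuous_on UNIV (divergence \<phi>)"
    unfolding divergence_def[abs_def]
    by (intro continuous_on_sum continuous_on_inner continuous_on_const bounded_frechet_derivative(1)[OF \<phi>])
  then have "divergence \<phi> \<in> borel_measurable borel"
    by (rule borel_measurable_continuous_onI)
  then show "divergence \<phi> \<in> borel_measurable lebesgue"
    by (intro measurable_completion) simp
  obtain B where B: "\<And>b x. norm (frechet_derivative \<phi> (at x) b) \<le> B b"
    using bounded_frechet_derivative(2)[OF \<phi>] by metis
  have "\<bar>divergence \<phi> x\<bar> \<le> (\<Sum>b\<in>Basis. B b)" for x
    unfolding divergence_def
  proof (rule order_trans[OF sum_abs sum_mono])
    fix b :: 'a assume "b \<in> Basis"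
    then show "\<bar>frechet_derivative \<phi> (at x) b \<bullet> b\<bar> \<le> B b"
      using Basis_le_norm[of b "frechet_derivative \<phi> (at x) b"] B[of x b] by linarith
  qed
  then show "\<exists>B. \<forall>x. \<bar>divergence \<phi> x\<bar> \<le> B" by blast
qed

lemma total_variation_distr_grad_cong_AE:
  fixes u v :: "'a::euclidean_space \<Rightarrow> real"
  assumes [measurable]: "u \<in> borel_measurable lebesgue" "v \<in> borel_measurable lebesgue"
    and ae: "AE x in lebesgue. u x = v x"
  shows "total_variation (distr_grad u) = total_variation (distr_grad v)"
  unfolding total_variation_def
proof (rule SUP_cong[OF refl])
  fix \<phi> :: "'a \<Rightarrow> 'a" assume "\<phi> \<in> {\<phi> \<in> test_fields. \<forall>x. norm (\<phi> x) \<le> 1}"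
  then have [measurable]: "divergence \<phi> \<in> borel_measurable lebesgue"
    using test_field_divergence(1) by blast
  have "distr_grad u \<phi> = distr_grad v \<phi>"
    unfolding distr_grad_def using ae by (auto intro!: integral_cong_AE)
  then show "ennreal \<bar>distr_grad u \<phi>\<bar> = ennreal \<bar>distr_grad v \<phi>\<bar>" by simp
qed

text \<open>A convergent sequence of values 0 and 1 is eventually constant, so convergence of
  indicators almost everywhere means stabilization of membership. Taking E as the set-theoretic
  lower limit of the sets, rather than from the limit function, gives the inclusion in \<Omega> at
  every point and not only almost everywhere.\<close>

lemma BV_sets_AE_compact:
  fixes C :: "nat \<Rightarrow> 'a::euclidean_space set"
  assumes C: "\<And>n. C n \<in> sets lebesgue" "\<And>n. C n \<subseteq> \<Omega>" and "bounded \<Omega>"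
    and tv: "\<And>n. total_variation (distr_grad (indicator (C n))) \<le> ennreal M" and M: "M \<ge> 0"
  obtains k E where "strict_mono (k :: nat \<Rightarrow> nat)" "E \<in> sets lebesgue" "E \<subseteq> \<Omega>"
    "AE x in lebesgue. \<forall>\<^sub>F n in sequentially. x \<in> C (k n) \<longleftrightarrow> x \<in> E"
proof -
  obtain R where R: "\<Omega> \<subseteq> ball 0 R"
    using \<open>bounded \<Omega>\<close> bounded_subset_ballD by blast
  have "\<forall>n. \<exists>B. B \<in> sets borel \<and> B \<subseteq> C n \<and> (AE x in lebesgue. x \<in> B \<longleftrightarrow> x \<in> C n)"
    using lebesgue_set_almost_borel_subset[OF C(1)] by metis
  then obtain B where B: "\<And>n. B n \<in> sets borel" "\<And>n. B n \<subseteq> C n" "\<And>n. AE x in lebesgue. x \<in> B n \<longleftrightarrow> x \<in> C n"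
    by metis
  have BR: "B n \<subseteq> ball 0 R" for n
    using B(2)[of n] C(2)[of n] R by blast
  have tvB: "total_variation (distr_grad (indicator (B n))) \<le> ennreal M" for n
  proof -
    have "total_variation (distr_grad (indicator (B n))) = total_variation (distr_grad (indicator (C n)))"
    proof (rule total_variation_distr_grad_cong_AE)
      show "indicat_real (B n) \<in> borel_measurable lebesgue" "indicat_real (C n) \<in> borel_measurable lebesgue"
        using B(1)[of n] C(1)[of n] by (auto intro!: borel_measurable_indicator)
      show "AE x in lebesgue. indicat_real (B n) x = indicat_real (C n) x"
        using B(3)[of n] by eventually_elim (simp add: indicator_def)
    qed
    then show ?thesis using tv by simp
  qed
  obtain k :: "nat \<Rightarrow> nat" where k: "strict_mono k"
    "\<forall>e>0. \<exists>N. \<forall>i\<ge>N. \<forall>j\<ge>N. (LINT x|lborel. norm (indicat_real (B (k i)) x - indicat_real (B (k j)) x)) < e"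
    by (rule BV_sets_L1_compact_borel[where C = B, OF B(1) BR tvB M])
  have "integrable lborel (indicat_real (B (k n)))" for n
    using BR bounded_ball bounded_subset by (intro integrable_indicator_bounded B(1)) blast
  then obtain r f where r: "strict_mono r" "AE x in lborel. (\<lambda>i. indicat_real (B (k (r i))) x) \<longlonglongrightarrow> f x"
    by (rule L1_Cauchy_convergent_subseq[where s = "\<lambda>n. indicat_real (B (k n))"]) (use k(2) in blast)
  define E where "E = (\<Union>N. \<Inter>n\<in>{N..}. C (k (r n)))"
  show thesis
  proof (rule that[of "k \<circ> r" E])
    show "strict_mono (k \<circ> r)"
      using k(1) r(1) by (rule strict_mono_o)
    show "E \<in> sets lebesgue"
      unfolding E_def by (intro sets.countable_UN sets.countable_INT image_subsetI) (auto simp: C)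
    show "E \<subseteq> \<Omega>"
      unfolding E_def using C(2) by blast
    have "AE x in lebesgue. \<forall>n. x \<in> B n \<longleftrightarrow> x \<in> C n"
      using B(3) by (simp add: AE_all_countable)
    with AE_completion[OF r(2)]
    show "AE x in lebesgue. \<forall>\<^sub>F n in sequentially. x \<in> C ((k \<circ> r) n) \<longleftrightarrow> x \<in> E"
    proof eventually_elim
      case (elim x)
      have "Cauchy (\<lambda>i. indicat_real (C (k (r i))) x)"
        using LIMSEQ_imp_Cauchy[OF elim(1)] elim(2) by (simp add: indicator_def)
      \<comment> \<open>Two indicator values at distance less than 1 are equal.\<close>
      then obtain N where N: "\<And>m n. m \<ge> N \<Longrightarrow> n \<ge> N \<Longrightarrow>
          norm (indicat_real (C (k (r m))) x - indicat_real (C (k (r n))) x) < 1"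
        using CauchyD[of _ 1] by fastforce
      have same: "x \<in> C (k (r n)) \<longleftrightarrow> x \<in> C (k (r N))" if "n \<ge> N" for n
        using N[OF that order_refl] by (auto simp: indicator_def split: if_splits)
      have "x \<in> E \<longleftrightarrow> x \<in> C (k (r N))"
      proof
        assume "x \<in> E"
        then obtain N' where "\<forall>n\<ge>N'. x \<in> C (k (r n))"
          by (auto simp: E_def)
        then show "x \<in> C (k (r N))"
          using same[of "max N N'"] by auto
      next
        assume "x \<in> C (k (r N))"
        then show "x \<in> E"
          unfolding E_def using same by blast
      qed
      then have "x \<in> C ((k \<circ> r) n) \<longleftrightarrow> x \<in> E" if "n \<ge> N" for n
        using same[OF that] by simp
      then show ?case
        by (rule eventually_sequentiallyI)
    qed
  qed
qed

text \<open>Against a fixed test field the pairing converges: its divergence is bounded and all sets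
  lie in the bounded \<Omega>, so a multiple of the indicator of \<Omega> dominates.\<close>

lemma total_variation_indicator_liminf:
  fixes C :: "nat \<Rightarrow> 'a::euclidean_space set"
  assumes C: "\<And>n. C n \<in> sets lebesgue" "\<And>n. C n \<subseteq> \<Omega>" and E: "E \<in> sets lebesgue"
    and \<Omega>: "bounded \<Omega>" "\<Omega> \<in> sets lebesgue"
    and ae: "AE x in lebesgue. \<forall>\<^sub>F n in sequentially. x \<in> C n \<longleftrightarrow> x \<in> E"
  shows "total_variation (distr_grad (indicator E)) \<le> liminf (\<lambda>n. total_variation (distr_grad (indicator (C n))))"
  unfolding total_variation_def[of "distr_grad (indicator E)"]
proof (rule SUP_least)
  fix \<phi> :: "'a \<Rightarrow> 'a" assume \<phi>: "\<phi> \<in> {\<phi> \<in> test_fields. \<forall>x. norm (\<phi> x) \<le> 1}"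
  then have [measurable]: "divergence \<phi> \<in> borel_measurable lebesgue"
    using test_field_divergence(1) by blast
  obtain B where B: "\<And>x. \<bar>divergence \<phi> x\<bar> \<le> B"
    using test_field_divergence(2) \<phi> by blast
  have [measurable]: "C n \<in> sets lebesgue" "E \<in> sets lebesgue" for n
    by fact+
  have "\<Omega> \<in> lmeasurable"
    using \<Omega> by (rule bounded_set_imp_lmeasurable)
  then have w: "integrable lebesgue (\<lambda>x. B * indicat_real \<Omega> x)"
    by (intro integrable_mult_right integrable_real_indicator) (auto simp: fmeasurable_def)
  have "(\<lambda>n. LINT x|lebesgue. indicator (C n) x * divergence \<phi> x) \<longlonglongrightarrow> (LINT x|lebesgue. indicator E x * divergence \<phi> x)"
  proof (rule integral_dominated_convergence[OF _ _ w])
    show "AE x in lebesgue. (\<lambda>n. indicator (C n) x * divergence \<phi> x) \<longlonglongrightarrow> indicator E x * divergence \<phi> x"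
      using ae by eventually_elim (auto intro!: tendsto_eventually elim!: eventually_mono simp: indicator_def)
    show "AE x in lebesgue. norm (indicator (C n) x * divergence \<phi> x) \<le> B * indicat_real \<Omega> x" for n
      using B order_trans[OF abs_ge_zero B] C(2)[of n] by (intro AE_I2) (auto simp: indicator_def)
  qed measurable
  then have "(\<lambda>n. ennreal \<bar>distr_grad (indicator (C n)) \<phi>\<bar>) \<longlonglongrightarrow> ennreal \<bar>distr_grad (indicator E) \<phi>\<bar>"
    unfolding distr_grad_def by (intro tendsto_ennrealI tendsto_rabs tendsto_minus)
  then have "ennreal \<bar>distr_grad (indicator E) \<phi>\<bar> = liminf (\<lambda>n. ennreal \<bar>distr_grad (indicator (C n)) \<phi>\<bar>)"
    by (rule lim_imp_Liminf[OF sequentially_bot, symmetric])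
  also have "\<dots> \<le> liminf (\<lambda>n. total_variation (distr_grad (indicator (C n))))"
    using \<phi> by (intro Liminf_mono always_eventually allI) (auto simp: total_variation_def intro: SUP_upper)
  finally show "ennreal \<bar>distr_grad (indicator E) \<phi>\<bar> \<le> liminf (\<lambda>n. total_variation (distr_grad (indicator (C n))))" .
qed

text \<open>The indicator is integrable, so membership in \<open>BV\<close> fails only when the
  variation is infinite, and then both sides are infinite.\<close>

lemma Per_eq_total_variation:
  assumes "C \<in> sets lebesgue" "bounded C"
  shows "Per C = total_variation (distr_grad (indicator C))"
proof -
  have "C \<in> lmeasurable"
    using assms by (intro bounded_set_imp_lmeasurable)
  then have "integrable lebesgue (indicat_real C)"
    by (intro integrable_real_indicator) (auto simp: fmeasurable_def)
  then show ?thesis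
    by (cases "total_variation (distr_grad (indicat_real C)) = \<top>") (auto simp: Per_def BV_def less_top)
qed

section \<open>Decreasing sequences of convex sets of integrable functions\<close>

text \<open>It is strictly convex, unlike the norm, and grows only linearly, so that its integral is
  finite for every integrable function on a finite measure space.\<close>

definition japanese_bracket :: "'a::real_inner \<Rightarrow> real" where
  "japanese_bracket s = sqrt (1 + (norm s)\<^sup>2)"

lemma japanese_bracket_bounds:
  "1 \<le> japanese_bracket s" "norm s \<le> japanese_bracket s" "japanese_bracket s \<le> 1 + norm s"
  "(japanese_bracket s)\<^sup>2 = 1 + s \<bullet> s"
proof -
  show "1 \<le> japanese_bracket s" "norm s \<le> japanese_bracket s"
    by (auto simp: japanese_bracket_def intro: real_le_rsqrt)
  show "japanese_bracket s \<le> 1 + norm s"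
    unfolding japanese_bracket_def by (rule real_le_lsqrt) (auto simp: power2_eq_square algebra_simps)
  show "(japanese_bracket s)\<^sup>2 = 1 + s \<bullet> s"
    by (simp add: japanese_bracket_def power2_norm_eq_inner)
qed

lemma continuous_japanese_bracket [continuous_intros]:
  "continuous_on UNIV (japanese_bracket :: 'a::real_inner \<Rightarrow> real)"
  unfolding japanese_bracket_def by (intro continuous_intros)

text \<open>The lower bound on the gap makes the strict convexity of the bracket uniform on bounded sets.\<close>

lemma japanese_bracket_midpoint_gap:
  fixes a b :: "'a::real_inner"
  defines "A \<equiv> japanese_bracket a" and "B \<equiv> japanese_bracket b"
    and "m \<equiv> japanese_bracket ((1/2) *\<^sub>R (a + b))"
  shows "m \<le> (A + B) / 2" "(norm (a - b))\<^sup>2 \<le> (A + B) ^ 3 * ((A + B) / 2 - m)"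
proof -
  have A: "1 \<le> A" "A\<^sup>2 = 1 + a \<bullet> a" and B: "1 \<le> B" "B\<^sup>2 = 1 + b \<bullet> b"
    and m: "1 \<le> m" "m\<^sup>2 = 1 + (a \<bullet> a + 2 * (a \<bullet> b) + b \<bullet> b) / 4"
    by (simp_all add: A_def B_def m_def japanese_bracket_bounds inner_add inner_commute)
  \<comment> \<open>D is the defect in the Cauchy-Schwarz inequality for the vectors (1, a) and (1,
    b), whose lengths are A and B. The difference of squares below is the Lagrange identity with a
    nonnegative part dropped.\<close>
  define D where "D = A * B - 1 - a \<bullet> b"
  have "(a \<bullet> b)\<^sup>2 \<le> (a \<bullet> a) * (b \<bullet> b)"
    by (rule Cauchy_Schwarz_ineq)
  then have sq: "(A * B)\<^sup>2 - (1 + a \<bullet> b)\<^sup>2 \<ge> (norm (a - b))\<^sup>2"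
  proof -
    have "(norm (a - b))\<^sup>2 = a \<bullet> a - 2 * (a \<bullet> b) + b \<bullet> b"
      by (simp add: power2_norm_eq_inner inner_diff inner_commute)
    then show ?thesis
      using \<open>(a \<bullet> b)\<^sup>2 \<le> _\<close> unfolding power_mult_distrib A(2) B(2)
      by (simp add: power2_eq_square algebra_simps)
  qed
  then have "(1 + a \<bullet> b)\<^sup>2 \<le> (A * B)\<^sup>2"
    using zero_le_power2[of "norm (a - b)"] by linarith
  then have abs: "\<bar>1 + a \<bullet> b\<bar> \<le> A * B"
    using A B by (simp add: abs_le_square_iff[symmetric])
  have D0: "D \<ge> 0"
    using abs by (simp add: D_def)
  have "D * (A * B + 1 + a \<bullet> b) \<ge> (norm (a - b))\<^sup>2"
    using sq by (simp add: D_def power2_eq_square algebra_simps)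
  moreover have "D * (A * B + 1 + a \<bullet> b) \<le> D * (2 * (A * B))"
    using D0 abs by (intro mult_left_mono) auto
  ultimately have 1: "(norm (a - b))\<^sup>2 \<le> 2 * (A * B) * D"
    by (simp add: mult_ac)
  \<comment> \<open>The gap times a factor of size at most A + B equals D / 2. Together with the
    bound by 2 A B D and 4 A B \<le> (A + B)^2 this produces the cube.\<close>
  have 2: "((A + B) / 2 - m) * ((A + B) / 2 + m) = D / 2"
  proof -
    have "((A + B) / 2 - m) * ((A + B) / 2 + m) = (A\<^sup>2 + B\<^sup>2 + 2 * (A * B)) / 4 - m\<^sup>2"
      by (simp add: power2_eq_square field_simps)
    also have "\<dots> = D / 2"
      unfolding A(2) B(2) m(2) D_def by (simp add: field_simps)
    finally show ?thesis .
  qed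
  show 3: "m \<le> (A + B) / 2"
  proof (rule ccontr)
    assume "\<not> ?thesis"
    moreover have "0 < (A + B) / 2 + m"
      using A(1) B(1) m(1) by (intro add_pos_pos divide_pos_pos) auto
    ultimately have "((A + B) / 2 - m) * ((A + B) / 2 + m) < 0"
      by (intro mult_neg_pos) auto
    then show False
      using 2 D0 by simp
  qed
  have "D / 2 \<le> ((A + B) / 2 - m) * (A + B)"
    unfolding 2[symmetric] using 3 by (intro mult_left_mono) (simp_all add: field_simps)
  then have "2 * (A * B) * D \<le> 2 * (A * B) * (2 * (((A + B) / 2 - m) * (A + B)))"
    using A B by (intro mult_left_mono) auto
  also have "\<dots> = (4 * (A * B)) * (((A + B) / 2 - m) * (A + B))"
    by simp
  also have "\<dots> \<le> (A + B)\<^sup>2 * (((A + B) / 2 - m) * (A + B))"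
  proof (rule mult_right_mono)
    show "4 * (A * B) \<le> (A + B)\<^sup>2"
      using zero_le_power2[of "A - B"] by (simp add: power2_eq_square algebra_simps)
  qed (use 3 A B in auto)
  finally show "(norm (a - b))\<^sup>2 \<le> (A + B) ^ 3 * ((A + B) / 2 - m)"
    using 1 by (simp add: power2_eq_square power3_eq_cube mult_ac)
qed

text \<open>For small \<epsilon> this turns a bound on the integral of \<Phi> into uniform
  integrability: large values contribute at most \<epsilon> times that bound.\<close>

lemma superlinear_bound:
  fixes \<Phi> :: "'b::real_normed_vector \<Rightarrow> real"
  assumes "LIM s at_infinity. \<Phi> s / norm s :> at_top" and "\<epsilon> > 0"
  obtains R where "R > 0" "\<And>s. norm s \<ge> R \<Longrightarrow> norm s \<le> \<epsilon> * \<Phi> s"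
proof -
  have "eventually (\<lambda>s. \<Phi> s / norm s \<ge> 1 / \<epsilon>) at_infinity"
    using assms(1) by (auto simp: filterlim_at_top)
  then obtain b where b: "\<And>s. norm s \<ge> b \<Longrightarrow> \<Phi> s / norm s \<ge> 1 / \<epsilon>"
    by (auto simp: eventually_at_infinity)
  show thesis
  proof (rule that[of "max b 1"])
    fix s :: 'b assume "max b 1 \<le> norm s"
    then have "\<Phi> s / norm s \<ge> 1 / \<epsilon>" "norm s > 0"
      using b[of s] by auto
    then show "norm s \<le> \<epsilon> * \<Phi> s"
      using \<open>\<epsilon> > 0\<close> by (simp add: field_simps)
  qed auto
qed

text \<open>
  Almost minimizers on \<open>K n\<close> of the integral of the Japanese bracket form a Cauchy sequence in
  $L^1$: the midpoint gap controls the difference where both functions are bounded, and the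
  superlinear \<open>\<Phi>\<close> controls it elsewhere.
\<close>

lemma decreasing_midpoint_convex_L1_Inter_nonempty:
  fixes K :: "nat \<Rightarrow> ('a \<Rightarrow> 'b::euclidean_space) set" and \<Phi> :: "'b \<Rightarrow> real"
  assumes "finite_measure M"
    and ne: "\<And>n. K n \<noteq> {}"
    and dec: "\<And>n. K (Suc n) \<subseteq> K n"
    and int: "\<And>f. f \<in> K 0 \<Longrightarrow> integrable M f"
    and mid: "\<And>n f g. f \<in> K n \<Longrightarrow> g \<in> K n \<Longrightarrow> (\<lambda>x. (1/2) *\<^sub>R (f x + g x)) \<in> K n"
    and \<Phi>: "continuous_on UNIV \<Phi>" "\<And>s. 0 \<le> \<Phi> s" "LIM s at_infinity. \<Phi> s / norm s :> at_top"
    and bound: "\<And>f. f \<in> K 0 \<Longrightarrow> (\<integral>\<^sup>+x. \<Phi> (f x) \<partial>M) \<le> ennreal B"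
    and closed: "\<And>n h f. (\<And>j. h j \<in> K n) \<Longrightarrow> integrable M f \<Longrightarrow> AE x in M. (\<lambda>j. h j x) \<longlonglongrightarrow> f x
      \<Longrightarrow> (\<lambda>j. LINT x|M. norm (h j x - f x)) \<longlonglongrightarrow> 0 \<Longrightarrow> f \<in> K n"
  shows "\<exists>f. \<forall>n. f \<in> K n"
proof -
  interpret finite_measure M by fact
  let ?\<psi> = "japanese_bracket :: 'b \<Rightarrow> real"
  define P where "P f = (LINT x|M. ?\<psi> (f x))" for f
  define J where "J n = (INF f\<in>K n. P f)" for n
  define \<mu> where "\<mu> = measure M (space M)"
  have antimono: "K m \<subseteq> K n" if "n \<le> m" for m n
    using dec that by (rule lift_Suc_antimono_le)
  have K0: "f \<in> K 0" if "f \<in> K n" for f n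
    using antimono[of 0 n] that by auto
  note cont_meas = borel_measurable_continuous_on[OF _ borel_measurable_integrable]
  have \<Phi>_int: "integrable M (\<lambda>x. \<Phi> (f x))" and \<Phi>_le: "(LINT x|M. \<Phi> (f x)) \<le> max B 0"
    if "f \<in> K n" for f n
  proof -
    have "(\<integral>\<^sup>+x. \<Phi> (f x) \<partial>M) \<le> ennreal (max B 0)"
      using bound[OF K0[OF that]] by (rule order_trans) (auto intro: ennreal_leI)
    moreover have "(\<lambda>x. \<Phi> (f x)) \<in> borel_measurable M"
      using \<Phi>(1) int[OF K0[OF that]] by (rule cont_meas)
    ultimately show 1: "integrable M (\<lambda>x. \<Phi> (f x))"
      using \<Phi>(2) by (auto simp: integrable_iff_bounded le_less_trans)
    have "ennreal (LINT x|M. \<Phi> (f x)) = (\<integral>\<^sup>+x. \<Phi> (f x) \<partial>M)"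
      using 1 \<Phi>(2) by (intro nn_integral_eq_integral[symmetric]) auto
    also have "\<dots> \<le> ennreal (max B 0)" by fact
    finally show "(LINT x|M. \<Phi> (f x)) \<le> max B 0"
      by (subst (asm) ennreal_le_iff) auto
  qed
  have \<psi>_int: "integrable M (\<lambda>x. ?\<psi> (f x))" if "f \<in> K n" for f n
  proof (rule Bochner_Integration.integrable_bound)
    show "integrable M (\<lambda>x. 1 + norm (f x))"
      using int[OF K0[OF that]] by auto
    show "(\<lambda>x. ?\<psi> (f x)) \<in> borel_measurable M"
      using continuous_japanese_bracket int[OF K0[OF that]] by (rule cont_meas)
    show "AE x in M. norm (?\<psi> (f x)) \<le> norm (1 + norm (f x))"
    proof (rule AE_I2)
      fix x
      show "norm (?\<psi> (f x)) \<le> norm (1 + norm (f x))"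
        using japanese_bracket_bounds(1,3)[of "f x"] by simp
    qed
  qed
  have P_nonneg: "0 \<le> P f" for f
    unfolding P_def by (rule integral_nonneg_AE) (simp add: japanese_bracket_def)
  have bdd: "bdd_below (P ` K n)" for n
    using P_nonneg by (auto simp: bdd_below_def)
  obtain R where R: "R > 0" "\<And>s. norm s \<ge> R \<Longrightarrow> norm s \<le> 1 * \<Phi> s"
    using superlinear_bound[OF \<Phi>(3), of 1] by auto
  have P_le: "P f \<le> (1 + R) * \<mu> + max B 0" if "f \<in> K n" for f n
  proof -
    have "?\<psi> s \<le> (1 + R) + \<Phi> s" for s
      using japanese_bracket_bounds(3)[of s] R(2)[of s] R(1) \<Phi>(2)[of s] by (cases "norm s \<ge> R") auto
    then have "P f \<le> (LINT x|M. (1 + R) + \<Phi> (f x))"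
      unfolding P_def using \<psi>_int[OF that] \<Phi>_int[OF that] by (intro integral_mono) auto
    also have "\<dots> = (1 + R) * \<mu> + (LINT x|M. \<Phi> (f x))"
      using \<Phi>_int[OF that] by (simp add: \<mu>_def)
    finally show ?thesis
      using \<Phi>_le[OF that] by simp
  qed
  have J_le: "J n \<le> P f" if "f \<in> K n" for f n
    unfolding J_def using that bdd by (intro cINF_lower)
  \<comment> \<open>The infima increase because the sets shrink, and superlinearity bounds them, so
    J n approaches its limit L. The difference L - J n measures how close to minimal the later t i
    are on the earlier set K n.\<close>
  have "incseq J"
    unfolding incseq_def J_def using antimono ne bdd by (intro allI impI cINF_superset_mono) auto
  moreover have "J n \<le> (1 + R) * \<mu> + max B 0" for n
    using J_le P_le ne[of n] by (meson ex_in_conv order_trans)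
  ultimately obtain L where L: "J \<longlonglongrightarrow> L" "\<And>n. J n \<le> L"
    using incseq_convergent by blast
  have "\<exists>f\<in>K n. P f < J n + 1 / Suc n" for n
    using cINF_less_iff[OF ne bdd, of n "J n + 1 / Suc n"] by (auto simp: J_def)
  then obtain t where t: "\<And>n. t n \<in> K n" and Pt: "\<And>n. P (t n) < J n + 1 / Suc n"
    by metis
  define G where "G f g x = (?\<psi> (f x) + ?\<psi> (g x)) / 2 - ?\<psi> ((1/2) *\<^sub>R (f x + g x))"
    for f g :: "'a \<Rightarrow> 'b" and x
  have G_nonneg: "0 \<le> G f g x" for f g x
    using japanese_bracket_midpoint_gap(1)[of "f x" "g x"] by (simp add: G_def)
  have G_int: "integrable M (G f g)" if "f \<in> K n" "g \<in> K n" for f g n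
    unfolding G_def using \<psi>_int[OF that(1)] \<psi>_int[OF that(2)] \<psi>_int[OF mid[OF that]] by auto
  \<comment> \<open>The midpoint of t i and t j is again in K n, so its integral is at least J n,
    while those of t i and t j are at most L + 1/(n + 1).\<close>
  have LINT_G: "(LINT x|M. G (t i) (t j) x) \<le> L - J n + 1 / Suc n" if "n \<le> i" "n \<le> j" for i j n
  proof -
    have K: "t i \<in> K n" "t j \<in> K n"
      using t antimono that by blast+
    have "(LINT x|M. G (t i) (t j) x) = (P (t i) + P (t j)) / 2 - P (\<lambda>x. (1/2) *\<^sub>R (t i x + t j x))"
      unfolding G_def P_def using \<psi>_int[OF K(1)] \<psi>_int[OF K(2)] \<psi>_int[OF mid[OF K]] by simp
    also have "\<dots> \<le> (P (t i) + P (t j)) / 2 - J n"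
      using J_le[OF mid[OF K]] by simp
    also have "\<dots> \<le> L - J n + 1 / Suc n"
    proof -
      have "P (t k) \<le> L + 1 / Suc n" if "n \<le> k" for k
      proof -
        have "1 / real (Suc k) \<le> 1 / real (Suc n)"
          using that by (intro divide_left_mono) auto
        then show ?thesis
          using Pt[of k] L(2)[of k] by linarith
      qed
      moreover have "(x + y) / 2 - w \<le> z - w + v" if "x \<le> z + v" "y \<le> z + v" for x y z v w :: real
        using that by (simp add: field_simps)
      ultimately show ?thesis
        using that by blast
    qed
    finally show ?thesis .
  qed
  have "\<exists>N. \<forall>i\<ge>N. \<forall>j\<ge>N. (LINT x|M. norm (t i x - t j x)) < e" if "e > 0" for e
  proof -
    define B' where "B' = max B 0 + 1"
    \<comment> \<open>The constants \<epsilon>, \<delta> and later N are chosen so that each of the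
      four terms integrated from \<open>pw\<close> is at most e/4: \<delta> itself, the gap, and the
      two terms with \<Phi>.\<close>
    define \<epsilon> where "\<epsilon> = e / (16 * B')"
    have "B' > 0" by (simp add: B'_def)
    then have "\<epsilon> > 0" using that by (simp add: \<epsilon>_def)
    define \<delta> where "\<delta> = e / (4 * (\<mu> + 1))"
    have "\<mu> \<ge> 0" by (simp add: \<mu>_def)
    then have "\<delta> > 0" using that by (simp add: \<delta>_def)
    obtain R where R: "R > 0" "\<And>s. norm s \<ge> R \<Longrightarrow> norm s \<le> \<epsilon> * \<Phi> s"
      using superlinear_bound[OF \<Phi>(3) \<open>\<epsilon> > 0\<close>] by auto
    define Q where "Q = R + 2"
    \<comment> \<open>A bracket above R + 2 forces a norm of at least R + 1, hence at least 1, so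
      the bracket is at most twice the norm.\<close>
    have Q: "?\<psi> s \<le> 2 * \<epsilon> * \<Phi> s" if "?\<psi> s > Q" for s
    proof -
      have "norm s \<ge> R + 1"
        using japanese_bracket_bounds(3)[of s] that by (simp add: Q_def)
      then show ?thesis
        using R(1) R(2)[of s] japanese_bracket_bounds(3)[of s] by simp
    qed
    \<comment> \<open>If both brackets are at most Q and the distance d exceeds \<delta>, then
      \<delta> d \<le> d^2 \<le> (2 Q)^3 times the gap; division by \<delta> gives c.\<close>
    define c where "c = (2 * Q) ^ 3 / \<delta>"
    have "c > 0" using R \<open>\<delta> > 0\<close> by (simp add: c_def Q_def)
    have pw: "norm (f x - g x) \<le> \<delta> + c * G f g x + 4 * \<epsilon> * \<Phi> (f x) + 4 * \<epsilon> * \<Phi> (g x)" for f g x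
    proof -
      let ?A = "?\<psi> (f x)" and ?B = "?\<psi> (g x)"
      have tri: "norm (f x - g x) \<le> ?A + ?B"
        using norm_triangle_ineq4[of "f x" "g x"] japanese_bracket_bounds(2)[of "f x"]
          japanese_bracket_bounds(2)[of "g x"] by linarith
      have pos: "0 \<le> c * G f g x" "0 \<le> \<epsilon> * \<Phi> (f x)" "0 \<le> \<epsilon> * \<Phi> (g x)"
        using \<open>c > 0\<close> \<open>\<epsilon> > 0\<close> G_nonneg[of f g x] \<Phi>(2) by auto
      show ?thesis
      proof (cases "?A \<le> Q \<and> ?B \<le> Q")
        case True
        show ?thesis
        proof (cases "norm (f x - g x) \<le> \<delta>")
          case False
          then have "\<delta> * norm (f x - g x) \<le> (norm (f x - g x))\<^sup>2"
            unfolding power2_eq_square by (intro mult_right_mono) auto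
          also have "\<dots> \<le> (?A + ?B) ^ 3 * G f g x"
            using japanese_bracket_midpoint_gap(2)[of "f x" "g x"] by (simp add: G_def)
          also have "\<dots> \<le> (2 * Q) ^ 3 * G f g x"
            using True japanese_bracket_bounds(1)[of "f x"] japanese_bracket_bounds(1)[of "g x"] G_nonneg
            by (intro mult_right_mono power_mono) auto
          finally have "norm (f x - g x) \<le> c * G f g x"
            using \<open>\<delta> > 0\<close> by (simp add: c_def field_simps)
          then show ?thesis
            using pos \<open>\<delta> > 0\<close> by linarith
        qed (use pos in linarith)
      next
        case False
        \<comment> \<open>The larger bracket exceeds Q, and the sum is at most twice the larger one;
          the term with \<Phi> at that point suffices.\<close>
        have "?A + ?B \<le> 4 * \<epsilon> * \<Phi> (f x) + 4 * \<epsilon> * \<Phi> (g x)"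
          using False pos Q[of "f x"] Q[of "g x"] by (cases "?A \<le> ?B") linarith+
        then show ?thesis
          using tri pos \<open>\<delta> > 0\<close> by linarith
      qed
    qed
    have "(\<lambda>n. L - J n + 1 / Suc n) \<longlonglongrightarrow> L - L + 0"
      by (intro tendsto_intros L LIMSEQ_Suc lim_1_over_n)
    then have "eventually (\<lambda>n. L - J n + 1 / Suc n < e / (4 * c)) sequentially"
      using \<open>c > 0\<close> \<open>e > 0\<close> by (intro order_tendstoD(2)) auto
    then obtain N where N: "L - J N + 1 / Suc N < e / (4 * c)"
      by (auto simp: eventually_sequentially)
    have "(LINT x|M. norm (t i x - t j x)) < e" if ij: "N \<le> i" "N \<le> j" for i j
    proof -
      have K: "t i \<in> K N" "t j \<in> K N"
        using t antimono that by blast+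
      have ints: "integrable M (G (t i) (t j))" "integrable M (\<lambda>x. \<Phi> (t i x))" "integrable M (\<lambda>x. \<Phi> (t j x))"
        using G_int[OF K] \<Phi>_int[OF K(1)] \<Phi>_int[OF K(2)] by auto
      have "(LINT x|M. norm (t i x - t j x))
          \<le> (LINT x|M. \<delta> + c * G (t i) (t j) x + 4 * \<epsilon> * \<Phi> (t i x) + 4 * \<epsilon> * \<Phi> (t j x))"
        using ints int[OF K0[OF K(1)]] int[OF K0[OF K(2)]] pw
        by (intro integral_mono) auto
      also have "\<dots> = \<delta> * \<mu> + c * (LINT x|M. G (t i) (t j) x) + 4 * \<epsilon> * (LINT x|M. \<Phi> (t i x))
          + 4 * \<epsilon> * (LINT x|M. \<Phi> (t j x))"
        using ints by (simp add: \<mu>_def)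
      also have "\<dots> < e / 4 + e / 4 + e / 4 + e / 4"
      proof -
        have c1: "\<delta> * \<mu> \<le> e / 4"
          using \<open>e > 0\<close> \<open>\<mu> \<ge> 0\<close> by (simp add: \<delta>_def field_simps)
        have c2: "c * (LINT x|M. G (t i) (t j) x) < e / 4"
          using le_less_trans[OF LINT_G[OF ij] N] \<open>c > 0\<close> by (simp add: field_simps)
        have c3: "4 * \<epsilon> * (LINT x|M. \<Phi> (t k x)) \<le> e / 4" if "t k \<in> K N" for k
        proof -
          have "4 * \<epsilon> * (LINT x|M. \<Phi> (t k x)) \<le> 4 * \<epsilon> * B'"
            using \<Phi>_le[OF that] \<open>\<epsilon> > 0\<close> by (intro mult_left_mono) (auto simp: B'_def)
          also have "\<dots> = e / 4"
            using \<open>B' > 0\<close> by (simp add: \<epsilon>_def)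
          finally show ?thesis .
        qed
        show ?thesis
          by (rule add_less_le_mono[OF add_less_le_mono[OF add_le_less_mono[OF c1 c2] c3[OF K(1)]] c3[OF K(2)]])
      qed
      finally show ?thesis by simp
    qed
    then show ?thesis by blast
  qed
  then obtain r f where r: "strict_mono r" and f: "integrable M f"
    "AE x in M. (\<lambda>i. t (r i) x) \<longlonglongrightarrow> f x" "(\<lambda>i. LINT x|M. norm (t (r i) x - f x)) \<longlonglongrightarrow> 0"
    by (rule L1_Cauchy_convergent_subseq[OF int[OF K0[OF t]]])
  have "f \<in> K n" for n
  \<comment> \<open>Dropping the first n terms puts the whole sequence into K n, since r (j + n)
    \<ge> n.\<close>
  proof (rule closed[where h = "\<lambda>j. t (r (j + n))"])
    fix j
    have "n \<le> r (j + n)"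
      using seq_suble[OF r, of "j + n"] by linarith
    then show "t (r (j + n)) \<in> K n"
      using t antimono by blast
  next
    show "AE x in M. (\<lambda>j. t (r (j + n)) x) \<longlonglongrightarrow> f x"
      using f(2) by eventually_elim (rule LIMSEQ_ignore_initial_segment)
    show "(\<lambda>j. LINT x|M. norm (t (r (j + n)) x - f x)) \<longlonglongrightarrow> 0"
      using f(3) by (rule LIMSEQ_ignore_initial_segment[of "\<lambda>i. LINT x|M. norm (t (r i) x - f x)"])
  qed (rule f)
  then show ?thesis by blast
qed

section \<open>Lower semicontinuity of the transport cost\<close>

lemma nn_integral_AE_limit_le:
  assumes [measurable]: "\<And>j. F j \<in> borel_measurable M"
    and lim: "AE x in M. (\<lambda>j. F j x) \<longlonglongrightarrow> G x" and le: "\<And>j. (\<integral>\<^sup>+x. F j x \<partial>M) \<le> a"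
  shows "(\<integral>\<^sup>+x. (G x :: ennreal) \<partial>M) \<le> a"
proof -
  have "(\<integral>\<^sup>+x. G x \<partial>M) = (\<integral>\<^sup>+x. liminf (\<lambda>j. F j x) \<partial>M)"
    using lim by (intro nn_integral_cong_AE) (auto elim!: eventually_mono simp: lim_imp_Liminf)
  also have "\<dots> \<le> liminf (\<lambda>j. \<integral>\<^sup>+x. F j x \<partial>M)"
    by (rule nn_integral_liminf) simp
  also have "\<dots> \<le> liminf (\<lambda>j::nat. a)"
    using le by (intro Liminf_mono always_eventually allI)
  also have "\<dots> = a"
    by (simp add: Liminf_const)
  finally show ?thesis .
qed

lemma nn_integral_midpoint_le:
  fixes a :: ennreal
  assumes [measurable]: "F \<in> borel_measurable M" "G \<in> borel_measurable M"
    and "(\<integral>\<^sup>+x. F x \<partial>M) \<le> a" "(\<integral>\<^sup>+x. G x \<partial>M) \<le> a"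
    and "\<And>x. D x \<le> ennreal (1/2) * (F x + G x)"
  shows "(\<integral>\<^sup>+x. D x \<partial>M) \<le> a"
proof -
  have "(\<integral>\<^sup>+x. D x \<partial>M) \<le> (\<integral>\<^sup>+x. ennreal (1/2) * (F x + G x) \<partial>M)"
    by (intro nn_integral_mono assms(5))
  also have "\<dots> = ennreal (1/2) * ((\<integral>\<^sup>+x. F x \<partial>M) + (\<integral>\<^sup>+x. G x \<partial>M))"
    by (simp add: nn_integral_cmult nn_integral_add)
  also have "\<dots> \<le> ennreal (1/2) * (a + a)"
    using assms(3,4) by (intro mult_left_mono add_mono) auto
  also have "\<dots> = (ennreal (1/2) + ennreal (1/2)) * a"
    by (simp only: distrib_left distrib_right)
  also have "ennreal (1/2) + ennreal (1/2) = ennreal (1/2 + 1/2)"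
    by (rule ennreal_plus[symmetric]) auto
  finally show ?thesis by simp
qed

section \<open>Admissible fluxes as a convex closed subset of L1\<close>

lemma smooth_grad_continuous:
  assumes "smooth \<phi>"
  shows "continuous_on UNIV (grad \<phi>)"
proof -
  have "C_class (Suc 0) \<phi>" using assms by (simp only: smooth_def)
  then show ?thesis
    unfolding grad_def[abs_def] by (intro continuous_on_sum continuous_on_scaleR continuous_on_const) simp
qed

text \<open>For bounded \<Omega> the restricted measure is finite, which is the setting of the
  abstract intersection lemma.\<close>

lemma admissible_fluxes_restrict_space:
  assumes "\<Omega> \<in> sets lebesgue"
  shows "\<sigma> \<in> admissible_fluxes \<Omega> fp fm \<longleftrightarrow> integrable (restrict_space lebesgue \<Omega>) \<sigma> \<and>
     (\<forall>\<phi>. smooth \<phi> \<longrightarrow> (LINT x|restrict_space lebesgue \<Omega>. \<sigma> x \<bullet> grad \<phi> x) =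
        (LINT x:closure \<Omega>|fp. \<phi> x) - (LINT x:closure \<Omega>|fm. \<phi> x))"
  using assms
  by (simp add: admissible_fluxes_def set_integrable_def set_lebesgue_integral_def
      integrable_restrict_space integral_restrict_space)

text \<open>A single integrand, depending on the point and convex in the flux when \<open>H1\<close>
  and \<open>H2\<close> are, replaces the two regions. Costs of different sets can then be compared
  pointwise.\<close>

lemma flux_cost_restrict_space:
  fixes H1 H2 :: "'a::euclidean_space \<Rightarrow> real"
  assumes \<Omega>: "\<Omega> \<in> sets lebesgue" and S: "S \<in> sets lebesgue"
    and H: "continuous_on UNIV H1" "continuous_on UNIV H2"
    and \<sigma>: "integrable (restrict_space lebesgue \<Omega>) \<sigma>"
  shows "(\<integral>\<^sup>+x\<in>\<Omega> - S. ennreal (H2 (\<sigma> x)) \<partial>lebesgue) + (\<integral>\<^sup>+x\<in>\<Omega> \<inter> S. ennreal (H1 (\<sigma> x)) \<partial>lebesgue)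
    = (\<integral>\<^sup>+x. ennreal (if x \<in> S then H1 (\<sigma> x) else H2 (\<sigma> x)) \<partial>restrict_space lebesgue \<Omega>)"
proof -
  let ?M = "restrict_space lebesgue \<Omega>"
  have [measurable]: "(\<lambda>x. H1 (\<sigma> x)) \<in> borel_measurable ?M" "(\<lambda>x. H2 (\<sigma> x)) \<in> borel_measurable ?M"
    using H \<sigma> by (auto intro: borel_measurable_continuous_on)
  have S': "Measurable.pred ?M (\<lambda>x. x \<in> S)"
    using S by (intro measurable_restrict_space1) (simp add: pred_def)
  note [measurable] = S'
  have "(\<integral>\<^sup>+x\<in>\<Omega> - S. ennreal (H2 (\<sigma> x)) \<partial>lebesgue) = (\<integral>\<^sup>+x. (if x \<in> S then 0 else ennreal (H2 (\<sigma> x))) \<partial>?M)"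
    using \<Omega> by (subst nn_integral_restrict_space) (auto intro!: nn_integral_cong simp: indicator_def)
  moreover have "(\<integral>\<^sup>+x\<in>\<Omega> \<inter> S. ennreal (H1 (\<sigma> x)) \<partial>lebesgue) = (\<integral>\<^sup>+x. (if x \<in> S then ennreal (H1 (\<sigma> x)) else 0) \<partial>?M)"
    using \<Omega> by (subst nn_integral_restrict_space) (auto intro!: nn_integral_cong simp: indicator_def)
  moreover have "(\<integral>\<^sup>+x. (if x \<in> S then 0 else ennreal (H2 (\<sigma> x))) \<partial>?M) + (\<integral>\<^sup>+x. (if x \<in> S then ennreal (H1 (\<sigma> x)) else 0) \<partial>?M)
      = (\<integral>\<^sup>+x. ennreal (if x \<in> S then H1 (\<sigma> x) else H2 (\<sigma> x)) \<partial>?M)"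
    by (subst nn_integral_add[symmetric]) (measurable, auto intro!: nn_integral_cong)
  ultimately show ?thesis by simp
qed

lemma convex_on_midpoint:
  "convex_on UNIV (H :: 'a::real_vector \<Rightarrow> real) \<Longrightarrow> H ((1/2) *\<^sub>R (s + t)) \<le> (H s + H t) / 2"
  using convex_onD[of UNIV H "1/2" s t] by (simp add: scaleR_add_right)

lemma smooth_grad_bounded:
  fixes \<Omega> :: "'a::euclidean_space set"
  assumes "bounded \<Omega>" and \<phi>: "smooth \<phi>"
  shows "\<exists>B. \<forall>x\<in>\<Omega>. norm (grad \<phi> x) \<le> B"
proof -
  have "compact (grad \<phi> ` closure \<Omega>)"
    using smooth_grad_continuous[OF \<phi>] assms(1)
    by (intro compact_continuous_image) (auto intro: continuous_on_subset)
  then have "bounded (grad \<phi> ` closure \<Omega>)"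
    by (rule compact_imp_bounded)
  then show ?thesis
    using closure_subset[of \<Omega>] unfolding bounded_iff by auto
qed

lemma integrable_inner_grad:
  fixes \<sigma> :: "'a::euclidean_space \<Rightarrow> 'a"
  assumes \<Omega>: "\<Omega> \<in> sets lebesgue" "bounded \<Omega>" and \<phi>: "smooth \<phi>"
    and \<sigma>: "integrable (restrict_space lebesgue \<Omega>) \<sigma>"
  shows "integrable (restrict_space lebesgue \<Omega>) (\<lambda>x. \<sigma> x \<bullet> grad \<phi> x)"
proof -
  let ?M = "restrict_space lebesgue \<Omega>"
  obtain B where B: "\<forall>x\<in>\<Omega>. norm (grad \<phi> x) \<le> B"
    using smooth_grad_bounded[OF \<Omega>(2) \<phi>] by blast
  have [measurable]: "grad \<phi> \<in> borel_measurable ?M"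
    using borel_measurable_continuous_onI[OF smooth_grad_continuous[OF \<phi>]]
    by (intro measurable_restrict_space1 measurable_completion) simp
  have [measurable]: "\<sigma> \<in> borel_measurable ?M"
    using \<sigma> by (rule borel_measurable_integrable)
  show ?thesis
  proof (rule Bochner_Integration.integrable_bound)
    show "integrable ?M (\<lambda>x. norm (\<sigma> x) * B)"
      using \<sigma> by auto
    show "AE x in ?M. norm (\<sigma> x \<bullet> grad \<phi> x) \<le> norm (norm (\<sigma> x) * B)"
    proof (rule AE_I2)
      fix x assume "x \<in> space ?M"
      then have "norm (grad \<phi> x) \<le> \<bar>B\<bar>"
        using B \<Omega>(1) by (fastforce simp: space_restrict_space)
      then have "norm (\<sigma> x) * norm (grad \<phi> x) \<le> norm (\<sigma> x) * \<bar>B\<bar>"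
        by (rule mult_left_mono) simp
      then show "norm (\<sigma> x \<bullet> grad \<phi> x) \<le> norm (norm (\<sigma> x) * B)"
        using Cauchy_Schwarz_ineq2[of "\<sigma> x" "grad \<phi> x"] by (simp add: abs_mult)
    qed
  qed measurable
qed

lemma admissible_fluxes_midpoint:
  fixes \<sigma> \<tau> :: "'a::euclidean_space \<Rightarrow> 'a"
  assumes \<Omega>: "\<Omega> \<in> sets lebesgue" "bounded \<Omega>"
    and st: "\<sigma> \<in> admissible_fluxes \<Omega> fp fm" "\<tau> \<in> admissible_fluxes \<Omega> fp fm"
  shows "(\<lambda>x. (1/2) *\<^sub>R (\<sigma> x + \<tau> x)) \<in> admissible_fluxes \<Omega> fp fm"
proof -
  let ?M = "restrict_space lebesgue \<Omega>"
  note adm = admissible_fluxes_restrict_space[OF \<Omega>(1)]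
  have int: "integrable ?M \<sigma>" "integrable ?M \<tau>"
    using st adm by blast+
  have "(LINT x|?M. ((1/2) *\<^sub>R (\<sigma> x + \<tau> x)) \<bullet> grad \<phi> x) =
      (LINT x:closure \<Omega>|fp. \<phi> x) - (LINT x:closure \<Omega>|fm. \<phi> x)" if \<phi>: "smooth \<phi>" for \<phi>
  proof -
    note inner = integrable_inner_grad[OF \<Omega> \<phi> int(1)] integrable_inner_grad[OF \<Omega> \<phi> int(2)]
    have "(LINT x|?M. ((1/2) *\<^sub>R (\<sigma> x + \<tau> x)) \<bullet> grad \<phi> x)
        = (1/2) * ((LINT x|?M. \<sigma> x \<bullet> grad \<phi> x) + (LINT x|?M. \<tau> x \<bullet> grad \<phi> x))"
      using inner by (simp add: inner_add_left)
    then show ?thesis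
      using st \<phi> adm by simp
  qed
  then show ?thesis
    using int adm by auto
qed

text \<open>The gradient of a smooth function is bounded on the bounded \<Omega>, so each weak
  constraint is a continuous linear equation in L1.\<close>

lemma admissible_fluxes_L1_closed:
  fixes \<sigma> :: "'a::euclidean_space \<Rightarrow> 'a"
  assumes \<Omega>: "\<Omega> \<in> sets lebesgue" "bounded \<Omega>"
    and h: "\<And>j. h j \<in> admissible_fluxes \<Omega> fp fm"
    and \<sigma>: "integrable (restrict_space lebesgue \<Omega>) \<sigma>"
    and lim: "(\<lambda>j. LINT x|restrict_space lebesgue \<Omega>. norm (h j x - \<sigma> x)) \<longlonglongrightarrow> 0"
  shows "\<sigma> \<in> admissible_fluxes \<Omega> fp fm"
proof -
  let ?M = "restrict_space lebesgue \<Omega>"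
  note adm = admissible_fluxes_restrict_space[OF \<Omega>(1)]
  have int: "integrable ?M (h j)" for j
    using h adm by blast
  have "(LINT x|?M. \<sigma> x \<bullet> grad \<phi> x) =
      (LINT x:closure \<Omega>|fp. \<phi> x) - (LINT x:closure \<Omega>|fm. \<phi> x)" (is "_ = ?c") if \<phi>: "smooth \<phi>" for \<phi>
  proof -
    note inner = integrable_inner_grad[OF \<Omega> \<phi>]
    obtain B where B: "\<forall>x\<in>\<Omega>. norm (grad \<phi> x) \<le> B"
      using smooth_grad_bounded[OF \<Omega>(2) \<phi>] by blast
    have "(\<lambda>j. (LINT x|?M. h j x \<bullet> grad \<phi> x) - (LINT x|?M. \<sigma> x \<bullet> grad \<phi> x)) \<longlonglongrightarrow> 0"
    proof (rule Lim_null_comparison[OF always_eventually])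
      show "(\<lambda>j. (LINT x|?M. norm (h j x - \<sigma> x)) * B) \<longlonglongrightarrow> 0"
        using lim by (rule tendsto_mult_left_zero)
      show "\<forall>j. norm ((LINT x|?M. h j x \<bullet> grad \<phi> x) - (LINT x|?M. \<sigma> x \<bullet> grad \<phi> x)) \<le> (LINT x|?M. norm (h j x - \<sigma> x)) * B"
      proof
        fix j
        have int': "integrable ?M (\<lambda>x. h j x - \<sigma> x)"
          using int \<sigma> by auto
        have "norm ((LINT x|?M. h j x \<bullet> grad \<phi> x) - (LINT x|?M. \<sigma> x \<bullet> grad \<phi> x))
            = norm (LINT x|?M. (h j x - \<sigma> x) \<bullet> grad \<phi> x)"
          using inner[OF int] inner[OF \<sigma>] by (simp add: inner_diff_left)
        also have "\<dots> \<le> (LINT x|?M. norm ((h j x - \<sigma> x) \<bullet> grad \<phi> x))"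
          by (rule integral_norm_bound)
        also have "\<dots> \<le> (LINT x|?M. norm (h j x - \<sigma> x) * B)"
        proof (rule integral_mono)
          show "integrable ?M (\<lambda>x. norm ((h j x - \<sigma> x) \<bullet> grad \<phi> x))"
            using inner[OF int'] by (rule integrable_norm)
          show "integrable ?M (\<lambda>x. norm (h j x - \<sigma> x) * B)"
            using int' by auto
          fix x assume "x \<in> space ?M"
          then have "norm (grad \<phi> x) \<le> B"
            using B \<Omega>(1) by (auto simp: space_restrict_space)
          then have "norm (h j x - \<sigma> x) * norm (grad \<phi> x) \<le> norm (h j x - \<sigma> x) * B"
            by (rule mult_left_mono) simp
          then show "norm ((h j x - \<sigma> x) \<bullet> grad \<phi> x) \<le> norm (h j x - \<sigma> x) * B"
            using Cauchy_Schwarz_ineq2[of "h j x - \<sigma> x" "grad \<phi> x"] by simp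
        qed
        also have "\<dots> = (LINT x|?M. norm (h j x - \<sigma> x)) * B"
          by simp
        finally show "norm ((LINT x|?M. h j x \<bullet> grad \<phi> x) - (LINT x|?M. \<sigma> x \<bullet> grad \<phi> x)) \<le> (LINT x|?M. norm (h j x - \<sigma> x)) * B" .
      qed
    qed
    moreover have "(LINT x|?M. h j x \<bullet> grad \<phi> x) = ?c" for j
      using h[of j] \<phi> adm by blast
    ultimately have "(\<lambda>j::nat. ?c - (LINT x|?M. \<sigma> x \<bullet> grad \<phi> x)) \<longlonglongrightarrow> 0"
      by simp
    then show ?thesis
      using LIMSEQ_unique tendsto_const by fastforce
  qed
  then show ?thesis
    using \<sigma> adm by blast
qed

text \<open>A flux lying in every K n has cost for E at most a on each \<open>T n\<close>, hence on
  \<Omega>, as these sets exhaust almost all of it. The separate bound on the \<open>H1\<close> cost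
  in K n is what lets \<open>H1\<close> serve as the superlinear function of the intersection lemma,
  even where no \<open>T n\<close> helps. The strict inequality in \<open>less\<close> provides
  actual fluxes without attaining the infimum.\<close>

lemma congested_cost_le_limit:
  fixes H1 H2 :: "'a::euclidean_space \<Rightarrow> real"
  assumes \<Omega>: "\<Omega> \<in> sets lebesgue" "bounded \<Omega>"
    and H1: "continuous_on UNIV H1" "convex_on UNIV H1" "\<And>s. 0 \<le> H1 s" "LIM s at_infinity. H1 s / norm s :> at_top"
    and H2: "continuous_on UNIV H2" "convex_on UNIV H2" "\<And>s. H1 s \<le> H2 s"
    and C: "\<And>n. C n \<in> sets lebesgue" and E: "E \<in> sets lebesgue"
    and ae: "AE x in lebesgue. \<forall>\<^sub>F n in sequentially. x \<in> C n \<longleftrightarrow> x \<in> E"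
    and less: "\<And>n. congested_cost \<Omega> fp fm H1 H2 (C n) < a"
    and a: "a < \<infinity>"
  shows "congested_cost \<Omega> fp fm H1 H2 E \<le> a"
proof -
  define M where "M = restrict_space lebesgue \<Omega>"
  have "\<Omega> \<in> lmeasurable"
    using \<Omega>(2,1) by (rule bounded_set_imp_lmeasurable)
  then interpret M: finite_measure M
    unfolding M_def by (intro finite_measureI) (auto simp: emeasure_restrict_space fmeasurable_def space_restrict_space \<Omega>)
  note adm = admissible_fluxes_restrict_space[OF \<Omega>(1), folded M_def]
  define h where "h S x s = (if x \<in> S then H1 s else H2 s)" for S and x s :: 'a
  note cost = flux_cost_restrict_space[OF \<Omega>(1) _ H1(1) H2(1), folded M_def h_def]
  have h: "H1 s \<le> h S x s" "0 \<le> h S x s" "h S x ((1/2) *\<^sub>R (s + t)) \<le> (h S x s + h S x t) / 2"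
    "(\<And>f l. f \<longlonglongrightarrow> l \<Longrightarrow> (\<lambda>j. h S x (f j)) \<longlonglongrightarrow> h S x l)" for S x s t
    using H1(3)[of s] H2(3)[of s] convex_on_midpoint[OF H1(2)] convex_on_midpoint[OF H2(2)] H1(1) H2(1)
    by (auto simp: h_def intro: continuous_on_tendsto_compose[of UNIV])
  define T where "T n = {x. \<forall>i\<ge>n. x \<in> C i \<longleftrightarrow> x \<in> E}" for n
  have T_sets: "T n \<in> sets lebesgue" for n
  proof -
    have "T n = (\<Inter>i\<in>{n..}. (C i \<inter> E) \<union> (- C i \<inter> - E))"
      by (auto simp: T_def)
    then show ?thesis
      using C E by (auto intro!: sets.countable_INT')
  qed
  have T_mono: "T n \<subseteq> T (Suc n)" for n
    by (auto simp: T_def)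
  have pred[measurable]: "Measurable.pred M (\<lambda>x. x \<in> S)" if "S \<in> sets lebesgue" for S
    unfolding M_def using that by (intro measurable_restrict_space1) (simp add: pred_def)
  have H_meas: "(\<lambda>x. H1 (\<sigma> x)) \<in> borel_measurable M" "(\<lambda>x. H2 (\<sigma> x)) \<in> borel_measurable M"
    if "integrable M \<sigma>" for \<sigma>
    using H1(1) H2(1) that by (auto intro: borel_measurable_continuous_on)
  have h_meas: "(\<lambda>x. ennreal (h S x (\<sigma> x))) \<in> borel_measurable M" if "S \<in> sets lebesgue" "integrable M \<sigma>" for S \<sigma>
    unfolding h_def using pred[OF that(1)] H_meas[OF that(2)] by measurable
  have T_meas: "indicator (T n) \<in> borel_measurable M" for n
    using pred[OF T_sets] by (simp add: indicator_def[abs_def])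
  \<comment> \<open>On \<open>T n\<close> the costs for \<open>C i\<close>, \<open>i \<ge> n\<close>, agree with the cost for \<open>E\<close>, so \<open>K n\<close> is convex and
    contains a competitor for \<open>C n\<close>.\<close>
  define K where "K n = {\<sigma> \<in> admissible_fluxes \<Omega> fp fm.
    (\<integral>\<^sup>+x. indicator (T n) x * ennreal (h E x (\<sigma> x)) \<partial>M) \<le> a \<and> (\<integral>\<^sup>+x. ennreal (H1 (\<sigma> x)) \<partial>M) \<le> a}" for n
  have K_meas: "(\<lambda>x. indicator (T n) x * ennreal (h E x (\<sigma> x))) \<in> borel_measurable M" if "integrable M \<sigma>" for n \<sigma>
    using T_meas h_meas[OF E that] by measurable
  have "\<exists>f. \<forall>n. f \<in> K n"
  proof (rule decreasing_midpoint_convex_L1_Inter_nonempty[OF M.finite_measure_axioms, where \<Phi> = H1 and B = "enn2real a"])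
    show "K n \<noteq> {}" for n
    proof -
      obtain \<sigma> where \<sigma>: "\<sigma> \<in> admissible_fluxes \<Omega> fp fm"
        "(\<integral>\<^sup>+x\<in>\<Omega> - C n. ennreal (H2 (\<sigma> x)) \<partial>lebesgue) + (\<integral>\<^sup>+x\<in>\<Omega> \<inter> C n. ennreal (H1 (\<sigma> x)) \<partial>lebesgue) < a"
        using less[of n] unfolding congested_cost_def INF_less_iff by blast
      then have "integrable M \<sigma>" using adm by blast
      \<comment> \<open>This one bound yields both conditions in K n: on \<open>T n\<close> the
        costs for C n and E agree, and \<open>H1\<close> is below the integrand everywhere.\<close>
      then have le: "(\<integral>\<^sup>+x. ennreal (h (C n) x (\<sigma> x)) \<partial>M) \<le> a"
        using cost[OF C] \<sigma>(2) by simp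
      have "(\<integral>\<^sup>+x. indicator (T n) x * ennreal (h E x (\<sigma> x)) \<partial>M) \<le> (\<integral>\<^sup>+x. ennreal (h (C n) x (\<sigma> x)) \<partial>M)"
        by (rule nn_integral_mono) (auto simp: indicator_def T_def h_def)
      moreover have "(\<integral>\<^sup>+x. ennreal (H1 (\<sigma> x)) \<partial>M) \<le> (\<integral>\<^sup>+x. ennreal (h (C n) x (\<sigma> x)) \<partial>M)"
        by (intro nn_integral_mono ennreal_leI h)
      ultimately have "\<sigma> \<in> K n"
        using \<sigma>(1) le by (auto simp: K_def)
      then show ?thesis by blast
    qed
    show "K (Suc n) \<subseteq> K n" for n
    proof
      fix \<sigma> assume \<sigma>: "\<sigma> \<in> K (Suc n)"
      have "(\<integral>\<^sup>+x. indicator (T n) x * ennreal (h E x (\<sigma> x)) \<partial>M) \<le> (\<integral>\<^sup>+x. indicator (T (Suc n)) x * ennreal (h E x (\<sigma> x)) \<partial>M)"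
        using T_mono[of n] by (intro nn_integral_mono mult_right_mono) (auto simp: indicator_def)
      then show "\<sigma> \<in> K n"
        using \<sigma> by (auto simp: K_def)
    qed
    show "integrable M \<sigma>" if "\<sigma> \<in> K 0" for \<sigma>
      using that adm by (auto simp: K_def)
    show "(\<lambda>x. (1/2) *\<^sub>R (\<sigma> x + \<tau> x)) \<in> K n" if "\<sigma> \<in> K n" "\<tau> \<in> K n" for \<sigma> \<tau> n
    proof -
      have st: "\<sigma> \<in> admissible_fluxes \<Omega> fp fm" "\<tau> \<in> admissible_fluxes \<Omega> fp fm" "integrable M \<sigma>" "integrable M \<tau>"
        using that adm by (auto simp: K_def)
      have half: "ennreal z \<le> ennreal (1/2) * (ennreal x + ennreal y)" if "z \<le> (x + y) / 2" "0 \<le> x" "0 \<le> y" for x y z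
      proof -
        have "ennreal z \<le> ennreal ((1/2) * (x + y))"
          using that(1) by (intro ennreal_leI) simp
        also have "\<dots> = ennreal (1/2) * (ennreal x + ennreal y)"
          using that(2,3) by (subst ennreal_mult) (auto simp: ennreal_plus)
        finally show ?thesis .
      qed
      have "(\<integral>\<^sup>+x. indicator (T n) x * ennreal (h E x ((1/2) *\<^sub>R (\<sigma> x + \<tau> x))) \<partial>M) \<le> a"
      proof (rule nn_integral_midpoint_le[OF K_meas[OF st(3)] K_meas[OF st(4)]])
        fix x
        show "indicator (T n) x * ennreal (h E x ((1/2) *\<^sub>R (\<sigma> x + \<tau> x)))
          \<le> ennreal (1/2) * (indicator (T n) x * ennreal (h E x (\<sigma> x)) + indicator (T n) x * ennreal (h E x (\<tau> x)))"
          using half[OF h(3) h(2) h(2), of E x "\<sigma> x" "\<tau> x"] by (simp add: indicator_def)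
      qed (use that in \<open>auto simp: K_def\<close>)
      moreover have "(\<integral>\<^sup>+x. ennreal (H1 ((1/2) *\<^sub>R (\<sigma> x + \<tau> x))) \<partial>M) \<le> a"
      proof (rule nn_integral_midpoint_le[of "\<lambda>x. ennreal (H1 (\<sigma> x))" _ "\<lambda>x. ennreal (H1 (\<tau> x))"])
        show "ennreal (H1 ((1/2) *\<^sub>R (\<sigma> x + \<tau> x))) \<le> ennreal (1/2) * (ennreal (H1 (\<sigma> x)) + ennreal (H1 (\<tau> x)))" for x
          by (rule half[OF convex_on_midpoint[OF H1(2)] H1(3) H1(3)])
      qed (use that H_meas(1)[OF st(3)] H_meas(1)[OF st(4)] in \<open>auto simp: K_def\<close>)
      ultimately show ?thesis
        using admissible_fluxes_midpoint[OF \<Omega> st(1,2)] by (simp add: K_def)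
    qed
    show "(\<integral>\<^sup>+x. ennreal (H1 (\<sigma> x)) \<partial>M) \<le> ennreal (enn2real a)" if "\<sigma> \<in> K 0" for \<sigma>
      using that a by (simp add: K_def)
    show "\<sigma> \<in> K n" if g: "\<And>j. g j \<in> K n" and \<sigma>: "integrable M \<sigma>" "AE x in M. (\<lambda>j. g j x) \<longlonglongrightarrow> \<sigma> x"
      "(\<lambda>j. LINT x|M. norm (g j x - \<sigma> x)) \<longlonglongrightarrow> 0" for n g \<sigma>
    proof -
      have gadm: "g j \<in> admissible_fluxes \<Omega> fp fm" and gint: "integrable M (g j)" for j
        using g adm by (auto simp: K_def)
      have "\<sigma> \<in> admissible_fluxes \<Omega> fp fm"
        using admissible_fluxes_L1_closed[OF \<Omega> gadm] \<sigma>(1,3) by (simp add: M_def)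
      moreover have "(\<integral>\<^sup>+x. indicator (T n) x * ennreal (h E x (\<sigma> x)) \<partial>M) \<le> a"
      proof (rule nn_integral_AE_limit_le[OF K_meas[OF gint]])
        show "AE x in M. (\<lambda>j. indicator (T n) x * ennreal (h E x (g j x))) \<longlonglongrightarrow> indicator (T n) x * ennreal (h E x (\<sigma> x))"
          using \<sigma>(2) by eventually_elim (intro ennreal_tendsto_cmult tendsto_ennrealI h(4), auto simp: indicator_def)
      qed (use g in \<open>auto simp: K_def\<close>)
      moreover have "(\<integral>\<^sup>+x. ennreal (H1 (\<sigma> x)) \<partial>M) \<le> a"
      proof (rule nn_integral_AE_limit_le[where F = "\<lambda>j x. ennreal (H1 (g j x))"])
        show "AE x in M. (\<lambda>j. ennreal (H1 (g j x))) \<longlonglongrightarrow> ennreal (H1 (\<sigma> x))"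
          using \<sigma>(2) by eventually_elim (intro tendsto_ennrealI continuous_on_tendsto_compose[OF H1(1)], auto)
      qed (use g H_meas(1)[OF gint] in \<open>auto simp: K_def\<close>)
      ultimately show ?thesis by (simp add: K_def)
    qed
  qed (use H1 in auto)
  then obtain \<sigma> where \<sigma>: "\<And>n. \<sigma> \<in> K n" by blast
  then have adm\<sigma>: "\<sigma> \<in> admissible_fluxes \<Omega> fp fm" and int\<sigma>: "integrable M \<sigma>"
    using adm by (auto simp: K_def)
  have aeM: "AE x in M. \<forall>\<^sub>F n in sequentially. x \<in> C n \<longleftrightarrow> x \<in> E"
    unfolding M_def using \<Omega>(1) ae by (subst AE_restrict_space_iff) auto
  have "(\<integral>\<^sup>+x. ennreal (h E x (\<sigma> x)) \<partial>M) \<le> a"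
  \<comment> \<open>The flux is now fixed and n grows: almost every point eventually belongs to
    \<open>T n\<close>, so the truncated integrands converge to the full one.\<close>
  proof (rule nn_integral_AE_limit_le[OF K_meas[OF int\<sigma>]])
    show "AE x in M. (\<lambda>n. indicator (T n) x * ennreal (h E x (\<sigma> x))) \<longlonglongrightarrow> ennreal (h E x (\<sigma> x))"
      using aeM
    proof eventually_elim
      case (elim x)
      then obtain N where "\<And>n. n \<ge> N \<Longrightarrow> x \<in> C n \<longleftrightarrow> x \<in> E"
        by (auto simp: eventually_sequentially)
      then have "x \<in> T n" if "n \<ge> N" for n
        using that by (auto simp: T_def)
      then show ?case
        by (intro tendsto_eventually eventually_sequentiallyI[of N]) simp
    qed
  qed (use \<sigma> in \<open>auto simp: K_def\<close>)
  then show ?thesis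
    unfolding congested_cost_def using cost[OF E int\<sigma>] by (intro INF_lower2[OF adm\<sigma>]) simp
qed

text \<open>If it failed, a level strictly between the two sides would be finite and would strictly
  exceed the cost along a subsequence, which is the situation of
  \<open>congested_cost_le_limit\<close>.\<close>

lemma congested_cost_liminf:
  fixes H1 H2 :: "'a::euclidean_space \<Rightarrow> real"
  assumes \<Omega>: "\<Omega> \<in> sets lebesgue" "bounded \<Omega>"
    and H1: "continuous_on UNIV H1" "convex_on UNIV H1" "\<And>s. 0 \<le> H1 s" "LIM s at_infinity. H1 s / norm s :> at_top"
    and H2: "continuous_on UNIV H2" "convex_on UNIV H2" "\<And>s. H1 s \<le> H2 s"
    and C: "\<And>n. C n \<in> sets lebesgue" and E: "E \<in> sets lebesgue"
    and ae: "AE x in lebesgue. \<forall>\<^sub>F n in sequentially. x \<in> C n \<longleftrightarrow> x \<in> E"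
  shows "congested_cost \<Omega> fp fm H1 H2 E \<le> liminf (\<lambda>n. congested_cost \<Omega> fp fm H1 H2 (C n))"
proof (rule ccontr)
  let ?F = "congested_cost \<Omega> fp fm H1 H2"
  assume "\<not> ?thesis"
  then have "liminf (\<lambda>n. ?F (C n)) < ?F E"
    by (simp only: not_le)
  from dense[OF this] obtain a where a: "liminf (\<lambda>n. ?F (C n)) < a" "a < ?F E"
    by blast
  have "\<not> (\<forall>\<^sub>F n in sequentially. a \<le> ?F (C n))"
  proof
    assume "\<forall>\<^sub>F n in sequentially. a \<le> ?F (C n)"
    then have "a \<le> liminf (\<lambda>n. ?F (C n))"
      by (rule Liminf_bounded)
    then show False
      using a(1) by simp
  qed
  from not_eventually_sequentiallyD[OF this]
  obtain s :: "nat \<Rightarrow> nat" where s: "strict_mono s" "\<And>n. \<not> a \<le> ?F (C (s n))"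
    by blast
  have "?F E \<le> a"
  proof (rule congested_cost_le_limit[OF \<Omega> H1 H2 C E])
    show "AE x in lebesgue. \<forall>\<^sub>F n in sequentially. x \<in> C (s n) \<longleftrightarrow> x \<in> E"
      using ae by eventually_elim (rule eventually_subseq[OF s(1)])
    show "?F (C (s n)) < a" for n
      using s(2) by (simp add: not_le)
    show "a < \<infinity>"
      using a(2) by (rule less_le_trans) simp
  qed
  then show False
    using a(2) by simp
qed

section \<open>Existence of an optimal set\<close>

text \<open>The infima over tails increase with the tail, so the supremum of their sum is the sum of
  the suprema.\<close>

lemma ennreal_liminf_add_cmult_le:
  fixes X Y :: "nat \<Rightarrow> ennreal"
  shows "liminf X + c * liminf Y \<le> liminf (\<lambda>n. X n + c * Y n)"
proof -
  have inc: "incseq (\<lambda>n. INF m\<in>{n..}. X m)" "incseq (\<lambda>n. c * (INF m\<in>{n..}. Y m))"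
    by (auto simp: incseq_def intro!: INF_superset_mono mult_left_mono)
  have "liminf X + c * liminf Y = (SUP n. (INF m\<in>{n..}. X m) + c * (INF m\<in>{n..}. Y m))"
    unfolding liminf_SUP_INF SUP_mult_left_ennreal using inc by (rule ennreal_SUP_add[symmetric])
  also have "\<dots> \<le> (SUP n. INF m\<in>{n..}. X m + c * Y m)"
    by (intro SUP_mono' INF_greatest add_mono mult_left_mono INF_lower) auto
  finally show ?thesis
    by (simp add: liminf_SUP_INF)
qed

theorem theorem2p1:
  fixes \<Omega> :: "'a::euclidean_space set"
    and fp fm :: "'a measure"
    and H1 H2 :: "'a \<Rightarrow> real"
    and k :: real
  assumes "bounded_Lipschitz_domain \<Omega>"
    and "prob_measure_on (closure \<Omega>) fp"
    and "prob_measure_on (closure \<Omega>) fm"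
    and "continuous_on UNIV H1" and "convex_on UNIV H1"
    and "continuous_on UNIV H2" and "convex_on UNIV H2"
    and "\<And>s. 0 \<le> H1 s" and "\<And>s. H1 s \<le> H2 s"
    and "LIM s at_infinity. H1 s / norm s :> at_top"
    and "LIM s at_infinity. H2 s / norm s :> at_top"
    and "k > 0"
    and "\<exists>C \<in> sets lebesgue. C \<subseteq> closure \<Omega> \<and> Per C < \<infinity> \<and>
           congested_cost \<Omega> fp fm H1 H2 C < \<infinity>"
  shows "\<exists>C_opt \<in> sets lebesgue. C_opt \<subseteq> \<Omega> \<and>
           (\<forall>C \<in> sets lebesgue. C \<subseteq> \<Omega> \<longrightarrow>
              congested_cost \<Omega> fp fm H1 H2 C_opt + ennreal k * Per C_opt
              \<le> congested_cost \<Omega> fp fm H1 H2 C + ennreal k * Per C)"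
proof -
  have \<Omega>: "\<Omega> \<in> sets lebesgue" "bounded \<Omega>"
    using assms(1) by (auto simp: bounded_Lipschitz_domain_def)
  let ?F = "congested_cost \<Omega> fp fm H1 H2"
  let ?A = "{C \<in> sets lebesgue. C \<subseteq> \<Omega>}"
  define J where "J C = ?F C + ennreal k * Per C" for C
  define I where "I = (INF C\<in>?A. J C)"
  have I_le: "I \<le> J C" if "C \<in> ?A" for C
    unfolding I_def using that by (rule INF_lower)
  have "\<exists>E\<in>?A. J E \<le> I"
  proof (cases "I = \<infinity>")
    case True
    \<comment> \<open>Here every candidate has infinite value, so any of them attains the
      infimum.\<close>
    then show ?thesis by (intro bexI[of _ "{}"]) auto
  next
    case False
    have "\<exists>C\<in>?A. J C < I + ennreal (1 / Suc n)" for n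
    proof -
      have "I < I + ennreal (1 / Suc n)"
        using False by (simp add: ennreal_add_left_cancel_less[of I 0, simplified] less_top)
      then show ?thesis
        unfolding I_def INF_less_iff .
    qed
    then obtain C where C: "\<And>n. C n \<in> ?A" and JC: "\<And>n. J (C n) < I + ennreal (1 / Suc n)"
      by metis
    have Cl: "C n \<in> sets lebesgue" and C\<Omega>: "C n \<subseteq> \<Omega>" for n
      using C by auto
    have Per: "Per S = total_variation (distr_grad (indicator S))" if "S \<in> ?A" for S
      using that \<Omega>(2) bounded_subset by (intro Per_eq_total_variation) auto
    \<comment> \<open>Since 1/(n + 1) \<le> 1 and the cost is nonnegative, k times each perimeter is
      at most I + 1, which is finite in this case.\<close>
    define M where "M = enn2real (I + 1) / k"
    have tv: "total_variation (distr_grad (indicator (C n))) \<le> ennreal M" for n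
    proof -
      have "ennreal k * Per (C n) \<le> J (C n)"
        by (simp add: J_def)
      also have "\<dots> \<le> I + ennreal (1 / Suc n)"
        using JC by (rule less_imp_le)
      also have "\<dots> \<le> I + 1"
        by (intro add_left_mono) (simp flip: ennreal_1 add: ennreal_leI del: ennreal_1)
      also have "\<dots> = ennreal k * ennreal M"
        using False \<open>k > 0\<close> by (simp add: M_def less_top flip: ennreal_mult)
      finally show ?thesis
        using \<open>k > 0\<close> Per[OF C] by (simp add: ennreal_mult_le_mult_iff)
    qed
    have M: "M \<ge> 0"
      using \<open>k > 0\<close> by (simp add: M_def)
    obtain r E where r: "strict_mono r" and E: "E \<in> sets lebesgue" "E \<subseteq> \<Omega>"
      and ae: "AE x in lebesgue. \<forall>\<^sub>F n in sequentially. x \<in> C (r n) \<longleftrightarrow> x \<in> E"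
      by (rule BV_sets_AE_compact[where C = C, OF Cl C\<Omega> \<Omega>(2) tv M])
    have "Per E \<le> liminf (\<lambda>n. Per (C (r n)))"
      using total_variation_indicator_liminf[of "\<lambda>n. C (r n)", OF Cl C\<Omega> E(1) \<Omega>(2,1) ae] Per E C by simp
    moreover have "?F E \<le> liminf (\<lambda>n. ?F (C (r n)))"
      by (rule congested_cost_liminf[OF \<Omega> assms(4,5,8,10,6,7,9) Cl E(1) ae])
    ultimately have "J E \<le> liminf (\<lambda>n. ?F (C (r n))) + ennreal k * liminf (\<lambda>n. Per (C (r n)))"
      unfolding J_def by (intro add_mono mult_left_mono) auto
    also have "\<dots> \<le> liminf (\<lambda>n. J (C (r n)))"
      unfolding J_def by (rule ennreal_liminf_add_cmult_le)
    also have "\<dots> \<le> liminf (\<lambda>n. I + ennreal (1 / Suc (r n)))"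
      using JC by (intro Liminf_mono always_eventually allI less_imp_le)
    also have "\<dots> = I"
    proof -
      have "(\<lambda>n. 1 / real (Suc n)) \<longlonglongrightarrow> 0"
        by (rule LIMSEQ_Suc[OF lim_1_over_n])
      then have "(\<lambda>n. 1 / real (Suc (r n))) \<longlonglongrightarrow> 0"
        using LIMSEQ_subseq_LIMSEQ[OF _ r, of "\<lambda>n. 1 / real (Suc n)"] by (simp add: comp_def)
      then have "(\<lambda>n. I + ennreal (1 / Suc (r n))) \<longlonglongrightarrow> I + ennreal 0"
        by (intro tendsto_add tendsto_const tendsto_ennrealI)
      from lim_imp_Liminf[OF sequentially_bot this] show ?thesis
        by simp
    qed
    finally show ?thesis
      using E by blast
  qed
  then obtain E where "E \<in> ?A" "J E \<le> I" by blast
  then show ?thesis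
    using order_trans[OF \<open>J E \<le> I\<close> I_le] unfolding J_def by blast
qed

end
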